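(* Let $\mu$ be a strong limit singular cardinal and let $\lambda>\mu$ be a regular cardinal. Then there is a cardinal $\kappa_0<\mu$ such that for every regular cardinal $\kappa$ with $\kappa_0\le\kappa<\mu$ the following three statements hold: (1) If $\lambda^{<\kappa}=\lambda$, then there is a sequence $\langle\mathcal{P}_\delta:\,\delta\in S^\lambda_\kappa\rangle$ such that (i) each $\mathcal{P}_\delta$ is a family of fewer than $\lambda$ elements of $[\delta]^{\le\kappa}$, and (ii) for every $A\in[\lambda]^\lambda$ there are stationarily many $\delta\in S^\lambda_\kappa$ such that for some $X\in\mathcal{P}_\delta$ we have $X\subseteq A$ and $\sup(X)=\delta$. (In particular $\clubsuit^-(S^\lambda_\kappa)$ holds.) (2) There is a sequence $\langle\mathcal{P}^0_\delta:\,\delta\in S^\lambda_\kappa\rangle$ such that each $\mathcal{P}^0_\delta$ is a family of fewer than $\lambda$ elements of $[\delta]^{\le\kappa}$, and for every $A\in[\lambda]^\lambda$ there is a club $E$ of $\lambda$ such that for every $\delta\in E\cap S^\lambda_\kappa$ there is $a\in\mathcal{P}^0_\delta$ with $\sup(A\cap a)=\delta$. (3) If for every cardinal $\theta<\lambda$ we have $\theta^{<\kappa}<\lambda$, then there is a sequence $\langle\mathcal{R}_\delta:\,\delta\in S^\lambda_\kappa\rangle$ such that each $\mathcal{R}_\delta$ is a family of fewer than $\lambda$ elements of $[\delta]^{\le\kappa}$, and for every sequence $\langle a_\delta:\,\delta\in S^\lambda_\kappa\rangle$ of sets such that each $a_\delta$ is a subset of $\delta$ of order type $\le\kappa$, there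 is a club $C$ of $\lambda$ such that $a_\delta\in\mathcal{R}_\delta$ for every $\delta\in C\cap S^\lambda_\kappa$.
   Context: For a regular cardinal $\kappa$ and an ordinal $\alpha>\kappa$, $S^\alpha_\kappa=\{\beta<\alpha:\,\mathrm{cf}(\beta)=\kappa\}$. For a set $X$ and cardinal $\nu$, $[X]^{\le\nu}$ (resp. $[X]^{\nu}$) is the set of subsets of $X$ of size $\le\nu$ (resp. exactly $\nu$). For a stationary $S\subseteq\lambda$, $\clubsuit^-(S)$ is the statement that there is a sequence $\langle\mathcal{P}_\delta:\,\delta\in S\rangle$ where each $\mathcal{P}_\delta$ is a family of fewer than $\lambda$ subsets of $\delta$, such that for every unbounded $A\subseteq\lambda$ there are stationarily many $\delta\in S$ for which some $X\in\mathcal{P}_\delta$ with $\sup(X)=\delta$ satisfies $X\subseteq A$. *)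

theory Defs
  imports Main
begin

unbundle cardinal_syntax

text \<open>Convention: the regular cardinal lambda is represented by a well-order r which is a
cardinal order (an initial ordinal) with Field r = lambda.  Ordinals below lambda are the
elements of Field r; the ordinal alpha is identified with the set  underS r alpha  of its
predecessors (ordered by r).  Cardinals below lambda are the initial ordinals in Field r.\<close>

definition ord_card :: "'a rel \<Rightarrow> 'a \<Rightarrow> 'a rel" where
  "ord_card r \<alpha> = (card_of (underS r \<alpha>))"

definition is_cardinal :: "'a rel \<Rightarrow> 'a \<Rightarrow> bool" where
  "is_cardinal r \<alpha> \<longleftrightarrow> \<alpha> \<in> Field r \<and> Card_order (Restr r (underS r \<alpha>))"

definition is_regular :: "'a rel \<Rightarrow> 'a \<Rightarrow> bool" where
  "is_regular r \<alpha> \<longleftrightarrow> is_cardinal r \<alpha> \<and> infinite (underS r \<alpha>)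
      \<and> regularCard (Restr r (underS r \<alpha>))"

definition olt :: "'a rel \<Rightarrow> 'a \<Rightarrow> 'a \<Rightarrow> bool" where
  "olt r \<alpha> \<beta> \<longleftrightarrow> (\<alpha>, \<beta>) \<in> r \<and> \<alpha> \<noteq> \<beta>"

definition is_sup :: "'a rel \<Rightarrow> 'a set \<Rightarrow> 'a \<Rightarrow> bool" where
  "is_sup r X \<delta> \<longleftrightarrow> \<delta> \<in> Field r \<and> (\<forall>x\<in>X. (x, \<delta>) \<in> r)
      \<and> (\<forall>\<beta>\<in>Field r. (\<forall>x\<in>X. (x, \<beta>) \<in> r) \<longrightarrow> (\<delta>, \<beta>) \<in> r)"

definition cof_eq :: "'a rel \<Rightarrow> 'a \<Rightarrow> 'a \<Rightarrow> bool" where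
  "cof_eq r \<delta> \<kappa> \<longleftrightarrow> \<delta> \<in> Field r \<and> is_cardinal r \<kappa>
      \<and> (\<exists>X. X \<subseteq> underS r \<delta> \<and> is_sup r X \<delta> \<and> (card_of (X)) =o ord_card r \<kappa>)
      \<and> (\<forall>X. X \<subseteq> underS r \<delta> \<and> is_sup r X \<delta> \<longrightarrow> ord_card r \<kappa> \<le>o (card_of (X)))"

definition S_cof :: "'a rel \<Rightarrow> 'a \<Rightarrow> 'a set" where
  "S_cof r \<kappa> = {\<delta> \<in> Field r. cof_eq r \<delta> \<kappa>}"

definition unbounded :: "'a rel \<Rightarrow> 'a set \<Rightarrow> bool" where
  "unbounded r C \<longleftrightarrow> C \<subseteq> Field r \<and> (\<forall>x\<in>Field r. \<exists>c\<in>C. (x, c) \<in> r)"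

definition club :: "'a rel \<Rightarrow> 'a set \<Rightarrow> bool" where
  "club r C \<longleftrightarrow> unbounded r C
      \<and> (\<forall>\<delta>\<in>Field r. C \<inter> underS r \<delta> \<noteq> {} \<and> is_sup r (C \<inter> underS r \<delta>) \<delta> \<longrightarrow> \<delta> \<in> C)"

definition stationary :: "'a rel \<Rightarrow> 'a set \<Rightarrow> bool" where
  "stationary r S \<longleftrightarrow> S \<subseteq> Field r \<and> (\<forall>C. club r C \<longrightarrow> S \<inter> C \<noteq> {})"

definition small_subset :: "'a rel \<Rightarrow> 'a \<Rightarrow> 'a \<Rightarrow> 'a set \<Rightarrow> bool" where
  "small_subset r \<kappa> \<delta> X \<longleftrightarrow> X \<subseteq> underS r \<delta> \<and> (card_of (X)) \<le>o ord_card r \<kappa>"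

definition small_family :: "'a rel \<Rightarrow> 'a \<Rightarrow> 'a \<Rightarrow> 'a set set \<Rightarrow> bool" where
  "small_family r \<kappa> \<delta> P \<longleftrightarrow> (card_of (P)) <o (card_of (Field r)) \<and> (\<forall>X\<in>P. small_subset r \<kappa> \<delta> X)"

text \<open>lambda^{<kappa} = lambda: lambda^nu <= lambda for every cardinal nu < kappa
  (the inequality lambda <= lambda^{<kappa} is automatic)\<close>
definition top_pow_below_eq :: "'a rel \<Rightarrow> 'a \<Rightarrow> bool" where
  "top_pow_below_eq r \<kappa> \<longleftrightarrow>
     (\<forall>\<nu>. is_cardinal r \<nu> \<and> olt r \<nu> \<kappa> \<longrightarrow> (card_of (Func (underS r \<nu>) (Field r))) \<le>o (card_of (Field r)))"

text \<open>theta^{<kappa} < lambda: the supremum of theta^nu (nu < kappa a cardinal) is bounded by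
  some cardinal beta < lambda\<close>
definition pow_below_lt_top :: "'a rel \<Rightarrow> 'a \<Rightarrow> 'a \<Rightarrow> bool" where
  "pow_below_lt_top r \<theta> \<kappa> \<longleftrightarrow> (\<exists>\<beta>\<in>Field r.
     \<forall>\<nu>. is_cardinal r \<nu> \<and> olt r \<nu> \<kappa> \<longrightarrow>
        (card_of (Func (underS r \<nu>) (underS r \<theta>))) \<le>o ord_card r \<beta>)"

definition strong_limit :: "'a rel \<Rightarrow> 'a \<Rightarrow> bool" where
  "strong_limit r \<mu> \<longleftrightarrow> is_cardinal r \<mu> \<and> infinite (underS r \<mu>)
     \<and> (\<forall>\<nu>. is_cardinal r \<nu> \<and> olt r \<nu> \<mu> \<longrightarrow> (card_of (Pow (underS r \<nu>))) <o ord_card r \<mu>)"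

definition singular :: "'a rel \<Rightarrow> 'a \<Rightarrow> bool" where
  "singular r \<mu> \<longleftrightarrow> is_cardinal r \<mu> \<and> (\<exists>\<nu>. cof_eq r \<mu> \<nu> \<and> olt r \<nu> \<mu>)"

end

theory Submission
  imports Defs
begin

text \<open>
  All three statements follow from the revised GCH (Shelah) for cardinals below \<open>\<lambda>\<close>: for every
  \<open>\<beta>\<close> there is \<open>K < \<mu>\<close> such that, for every \<open>\<Theta> < \<mu>\<close>, some family of at most \<open>|\<beta>|\<close> functions
  is such that every function from \<open>\<Theta>\<close> to \<open>\<beta>\<close> is pointwise covered by at most \<open>K\<close> of them.
  Since \<open>\<lambda>\<close> is regular above \<open>\<mu>\<close>, a single \<open>K\<close> serves unboundedly many \<open>\<beta> < \<lambda>\<close>. For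
  \<open>K < \<kappa> < \<mu>\<close> this yields, for each \<open>\<delta>\<close>, fewer than \<open>\<lambda>\<close> subsets of \<open>\<delta>\<close> such that every
  subset of \<open>\<delta>\<close> of size at most \<open>\<kappa>\<close> is a union of at most \<open>K\<close> of them; if it is cofinal in
  \<open>\<delta>\<close> of cofinality \<open>\<kappa>\<close>, one of the pieces is already cofinal.

  The revised GCH is proved by induction on \<open>|A|\<close>; only the case of a cofinal subset of size below
  \<open>\<mu>\<close> is hard. If it fails there, then for each \<open>K < \<mu>\<close> there are a \<open>K\<close>-complete ideal \<open>N\<close> and more
  than \<open>|A|\<close> functions, bounded below \<open>A\<close>, any two of which agree only on a set in \<open>N\<close>. Fix one
  such ideal and a bound \<open>f\<close> that is minimal modulo \<open>N\<close>. By minimality, few members of the family lie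
  below a given one on a non-negligible set, so one member \<open>g\<close> lies above \<open>|A|\<close> others. A second ideal
  of much larger completeness, applied to functions with values in those others, can be interchanged
  with the first one by the induction hypothesis for the values of \<open>g\<close>, and this produces more than
  \<open>|A|\<close> functions below \<open>g\<close>, against the minimality of \<open>f\<close>.
\<close>

subsection \<open>Cardinality\<close>

lemma not_card_le: "\<not> |A| \<le>o |B| \<longleftrightarrow> |B| <o |A|"
  by (rule not_ordLeq_iff_ordLess[OF card_of_Well_order card_of_Well_order])

text \<open>Regularity of the successor of |A|: at most |A| pieces of size at most |A| cannot fill a
  larger set.\<close>

lemma pigeonhole_card:
  assumes "infinite A" "|A| <o |I|" "f ` I \<subseteq> T" "|T| \<le>o |A|"
  shows "\<exists>t\<in>T. |A| <o |{i\<in>I. f i = t}|"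
proof (rule ccontr)
  assume "\<not> ?thesis"
  then have "\<forall>t\<in>T. |{i\<in>I. f i = t}| \<le>o |A|"
    using not_card_le by blast
  then have "|\<Union>t\<in>T. {i\<in>I. f i = t}| \<le>o |A|"
    using assms by (intro card_of_UNION_ordLeq_infinite) auto
  moreover have "(\<Union>t\<in>T. {i\<in>I. f i = t}) = I"
    using assms(3) by auto
  ultimately show False
    using assms(2) not_card_le by fastforce
qed

lemma card_finite_less:
  assumes "finite X" "infinite C" shows "|X| <o |C|"
  using assms card_of_ordLeq_finite not_card_le by blast

lemma card_Times_less:
  assumes "infinite C" "|X| <o |C|" "|Y| <o |C|"
  shows "|X \<times> Y| <o |C|"
proof (cases "finite (X <+> Y)")
  case True
  then show ?thesis using assms(1) card_finite_less by (metis finite_Plus_iff finite_cartesian_product)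
next
  case False
  have "|X \<times> Y| \<le>o |X <+> Y|"
    using False card_of_Plus1 card_of_Plus2
    by (metis card_of_Times_ordLeq_infinite_Field card_of_Card_order Field_card_of)
  then show ?thesis
    using card_of_Plus_ordLess_infinite[OF assms] ordLeq_ordLess_trans by blast
qed

lemma card_Pow_mono:
  assumes "|X| \<le>o |Y|" shows "|Pow X| \<le>o |Pow Y|"
proof -
  obtain f where "inj_on f X" "f ` X \<subseteq> Y" using iffD2[OF card_of_ordLeq assms] by auto
  then have "inj_on (image f) (Pow X)" "(image f) ` Pow X \<subseteq> Pow Y"
    by (auto simp: inj_on_image_Pow)
  then show ?thesis by (intro iffD1[OF card_of_ordLeq] exI conjI)
qed

lemma card_less_subset:
  assumes "|X| \<le>o |Y|" obtains Z where "Z \<subseteq> Y" "|X| =o |Z|"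
  using iffD1[OF internalize_card_of_ordLeq2 assms] that by blast

text \<open>\<open>M\<close> stands for \<open>\<mu>\<close>, and \<open>\<K>\<close> for
  representatives of a cofinal set of sizes below \<open>\<mu>\<close>. The assumptions on
  \<open>Y\<close> speak of subsets of \<open>M\<close> because a locale assumption fixes the type;
  \<open>small_Pow\<close> and \<open>cofinal_\<K>\<close> carry them over to sets of any type, such
  as iterated power sets and \<open>\<K>\<close> itself.\<close>

locale strong_limit_singular =
  fixes M :: "'a set" and \<K> :: "'a set set"
  assumes infinite_M: "infinite M"
    and small_Pow': "\<And>Y. Y \<subseteq> M \<Longrightarrow> |Y| <o |M| \<Longrightarrow> |Pow Y| <o |M|"
    and small_index: "|\<K>| <o |M|"
    and small_\<K>: "\<And>K. K \<in> \<K> \<Longrightarrow> |K| <o |M|"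
    and cofinal_\<K>': "\<And>Y. Y \<subseteq> M \<Longrightarrow> |Y| <o |M| \<Longrightarrow> \<exists>K\<in>\<K>. |Y| \<le>o |K|"
begin

lemma small_Pow: assumes "|Y| <o |M|" shows "|Pow Y| <o |M|"
proof -
  obtain Z where Z: "Z \<subseteq> M" "|Y| =o |Z|"
    by (rule card_less_subset[OF ordLess_imp_ordLeq[OF assms]])
  have "|Z| <o |M|" by (rule ordIso_ordLess_trans[OF ordIso_symmetric[OF Z(2)] assms])
  then show ?thesis
    by (rule ordLeq_ordLess_trans[OF card_Pow_mono[OF ordIso_imp_ordLeq[OF Z(2)]] small_Pow'[OF Z(1)]])
qed

lemmas small_Times = card_Times_less[OF infinite_M]

lemma cofinal_\<K>: assumes "|Y| <o |M|" shows "\<exists>K\<in>\<K>. |Y| \<le>o |K|"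
proof -
  obtain Z where Z: "Z \<subseteq> M" "|Y| =o |Z|"
    by (rule card_less_subset[OF ordLess_imp_ordLeq[OF assms]])
  have "|Z| <o |M|" by (rule ordIso_ordLess_trans[OF ordIso_symmetric[OF Z(2)] assms])
  then show ?thesis
    using cofinal_\<K>'[OF Z(1)] ordIso_ordLeq_trans[OF Z(2)] by blast
qed

text \<open>If all members were finite, so would be \<open>\<K>\<close>, being dominated by one of
  them; their sizes would then have a maximum, beaten by some finite subset of
  \<open>M\<close>.\<close>

lemma ex_infinite_\<K>: "\<exists>K\<in>\<K>. infinite K"
proof (rule ccontr)
  assume fin: "\<not> ?thesis"
  have "finite \<K>"
  proof (rule ccontr)
    assume "infinite \<K>"
    obtain K where "K \<in> \<K>" "|\<K>| \<le>o |K|" using cofinal_\<K>[OF small_index] by blast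
    then show False using fin \<open>infinite \<K>\<close> card_of_ordLeq_finite by blast
  qed
  define n where "n = Suc (Max (card ` \<K>))"
  obtain Y where Y: "Y \<subseteq> M" "finite Y" "card Y = n"
    using infinite_arbitrarily_large[OF infinite_M] by blast
  obtain K where K: "K \<in> \<K>" "|Y| \<le>o |K|"
    using cofinal_\<K>[OF card_finite_less[OF Y(2) infinite_M]] by blast
  have "card Y \<le> card K"
    using K fin card_of_ordLeq[of Y K] card_inj_on_le by blast
  also have "\<dots> \<le> Max (card ` \<K>)" using K \<open>finite \<K>\<close> by simp
  finally show False using Y n_def by simp
qed

lemma ex_large_\<K>:
  assumes "|Y| <o |M|" shows "\<exists>K\<in>\<K>. infinite K \<and> |Y| \<le>o |K|"
proof -
  obtain K0 where K0: "K0 \<in> \<K>" "infinite K0" using ex_infinite_\<K> by blast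
  have "|Y <+> K0| <o |M|"
    using card_of_Plus_ordLess_infinite[OF infinite_M assms small_\<K>[OF K0(1)]] .
  then obtain K where K: "K \<in> \<K>" "|Y <+> K0| \<le>o |K|" using cofinal_\<K> by blast
  then have "|Y| \<le>o |K|" "|K0| \<le>o |K|"
    using card_of_Plus1 card_of_Plus2 ordLeq_transitive by blast+
  then show ?thesis using K K0 card_of_ordLeq_finite by blast
qed

end

subsection \<open>Pointwise covers and ideals\<close>

definition covers :: "('b \<Rightarrow> 'c) set \<Rightarrow> 'b set \<Rightarrow> ('b \<Rightarrow> 'c) \<Rightarrow> bool" where
  "covers C \<Theta> k \<longleftrightarrow> (\<forall>\<zeta>\<in>\<Theta>. \<exists>h\<in>C. h \<zeta> = k \<zeta>)"

definition agree :: "('b \<Rightarrow> 'c) \<Rightarrow> ('b \<Rightarrow> 'c) \<Rightarrow> 'b set \<Rightarrow> 'b set" where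
  "agree g h \<Theta> = {\<zeta>\<in>\<Theta>. g \<zeta> = h \<zeta>}"

lemma covers_UNION: "(\<And>B. B \<in> \<B> \<Longrightarrow> covers (D B) B k) \<Longrightarrow> covers (\<Union>B\<in>\<B>. D B) (\<Union>\<B>) k"
  unfolding covers_def by simp metis

lemma covers_subset: "covers C X k \<Longrightarrow> Y \<subseteq> X \<Longrightarrow> covers C Y k"
  unfolding covers_def by auto

lemma covers_agree: "covers {g} (agree g k \<Theta>) k"
  unfolding covers_def agree_def by simp

text \<open>A form of the revised GCH at |A|: when functions are counted up to pointwise covers by
  |K| of them, the power of |A| by each size below |M| is at most |A|. The members of
  \<open>H\<close> may take values outside \<open>A\<close>.\<close>

definition pointwise_cover :: "'a set \<Rightarrow> 'a set \<Rightarrow> 'a set \<Rightarrow> bool" where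
  "pointwise_cover M A K \<longleftrightarrow> (\<forall>\<Theta>::'a set. |\<Theta>| <o |M| \<longrightarrow>
     (\<exists>H::('a \<Rightarrow> 'a) set. |H| \<le>o |A| \<and> (\<forall>k. k ` \<Theta> \<subseteq> A \<longrightarrow>
        (\<exists>C\<subseteq>H. |C| \<le>o |K| \<and> covers C \<Theta> k))))"

lemma pointwise_coverE:
  fixes \<Theta> :: "'a set"
  assumes "pointwise_cover M A K" "|\<Theta>| <o |M|"
  obtains H :: "('a \<Rightarrow> 'a) set" where "|H| \<le>o |A|"
    "\<forall>k. k ` \<Theta> \<subseteq> A \<longrightarrow> (\<exists>C\<subseteq>H. |C| \<le>o |K| \<and> covers C \<Theta> k)"
proof -
  from assms(1)[unfolded pointwise_cover_def, THEN spec, THEN mp, OF assms(2)]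
  obtain H where "|H| \<le>o |A| \<and> (\<forall>k. k ` \<Theta> \<subseteq> A \<longrightarrow> (\<exists>C\<subseteq>H. |C| \<le>o |K| \<and> covers C \<Theta> k))"
    by (elim exE)
  then show thesis by (intro that[of H]) simp_all
qed

text \<open>The case \<open>\<C> = {}\<close> puts the empty set into \<open>N\<close>. Neither an
  underlying set nor properness is built in; properness appears as a separate condition such as
  \<open>\<Theta> \<notin> N\<close>.\<close>

definition complete_ideal :: "'a set \<Rightarrow> 'a set set \<Rightarrow> bool" where
  "complete_ideal K N \<longleftrightarrow> (\<forall>X\<in>N. \<forall>Y\<subseteq>X. Y \<in> N) \<and> (\<forall>\<C>\<subseteq>N. |\<C>| \<le>o |K| \<longrightarrow> \<Union>\<C> \<in> N)"

lemma ideal_subset: "complete_ideal K N \<Longrightarrow> X \<in> N \<Longrightarrow> Y \<subseteq> X \<Longrightarrow> Y \<in> N"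
  unfolding complete_ideal_def by blast

lemma ideal_UNION:
  assumes "complete_ideal K N" "|I| \<le>o |K|" "\<And>i. i \<in> I \<Longrightarrow> X i \<in> N"
  shows "(\<Union>i\<in>I. X i) \<in> N"
proof -
  have "|X ` I| \<le>o |K|" using assms(2) card_of_image ordLeq_transitive by blast
  moreover have "X ` I \<subseteq> N" using assms(3) by blast
  ultimately show ?thesis using assms(1) unfolding complete_ideal_def by blast
qed

lemma ideal_Un:
  assumes "complete_ideal K N" "infinite K" "X \<in> N" "Y \<in> N" shows "X \<union> Y \<in> N"
proof -
  have "|{X, Y}| \<le>o |K|" using assms(2) by (intro ordLess_imp_ordLeq card_finite_less) simp_all
  then show ?thesis using ideal_UNION[OF assms(1), of "{X,Y}" id] assms by auto
qed

text \<open>Used to make a function constant on a positive set: it has at most |K| fibres, and if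
  all were in \<open>N\<close>, so would be their union \<open>B\<close>.\<close>

lemma ideal_piece:
  assumes "complete_ideal K N" "B \<notin> N" "f ` B \<subseteq> T" "|T| \<le>o |K|"
  shows "\<exists>t\<in>T. {\<epsilon>\<in>B. f \<epsilon> = t} \<notin> N"
proof (rule ccontr)
  assume "\<not> ?thesis"
  then have "(\<Union>t\<in>T. {\<epsilon>\<in>B. f \<epsilon> = t}) \<in> N"
    by (intro ideal_UNION[OF assms(1,4)]) blast
  moreover have "(\<Union>t\<in>T. {\<epsilon>\<in>B. f \<epsilon> = t}) = B" using assms(3) by blast
  ultimately show False using assms(2) by simp
qed

section \<open>Families of functions that differ pairwise modulo an ideal\<close>

definition ideal_different :: "'a set set \<Rightarrow> 'a set \<Rightarrow> ('a \<Rightarrow> 'a) set \<Rightarrow> bool" where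
  "ideal_different N \<Theta> F \<longleftrightarrow> (\<forall>g\<in>F. \<forall>h\<in>F. g \<noteq> h \<longrightarrow> agree g h \<Theta> \<in> N)"

text \<open>Zorn's lemma applies because the property concerns two functions at a time and so passes
  to unions of chains.\<close>

lemma ex_maximal_different:
  "\<exists>F\<subseteq>U. ideal_different N \<Theta> F \<and>
     (\<forall>k\<in>U. k \<notin> F \<longrightarrow> (\<exists>g\<in>F. agree g k \<Theta> \<notin> N))"
proof -
  let ?\<F> = "{F. F \<subseteq> U \<and> ideal_different N \<Theta> F}"
  have "\<exists>F\<in>?\<F>. \<forall>X\<in>?\<F>. F \<subseteq> X \<longrightarrow> X = F"
  proof (rule subset_Zorn')
    fix \<C> assume C: "subset.chain ?\<F> \<C>"
    have "ideal_different N \<Theta> (\<Union>\<C>)"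
      unfolding ideal_different_def
    proof (intro ballI impI)
      fix g h assume "g \<in> \<Union>\<C>" "h \<in> \<Union>\<C>" "g \<noteq> h"
      then obtain F where "F \<in> \<C>" "g \<in> F" "h \<in> F"
        using C unfolding subset.chain_def by blast
      then show "agree g h \<Theta> \<in> N"
        using C \<open>g \<noteq> h\<close> unfolding subset.chain_def ideal_different_def by blast
    qed
    then show "\<Union>\<C> \<in> ?\<F>" using C unfolding subset.chain_def by blast
  qed
  then obtain F where "F \<in> ?\<F>" and max': "\<forall>X\<in>?\<F>. F \<subseteq> X \<longrightarrow> X = F" by (rule bexE)
  then have F: "F \<subseteq> U" "ideal_different N \<Theta> F" by simp_all
  have max: "X = F" if "X \<subseteq> U" "ideal_different N \<Theta> X" "F \<subseteq> X" for X
    using max' that by simp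
  have "\<exists>g\<in>F. agree g k \<Theta> \<notin> N" if "k \<in> U" "k \<notin> F" for k
  proof (rule ccontr)
    assume "\<not> ?thesis"
    then have "agree g k \<Theta> \<in> N" "agree k g \<Theta> \<in> N" if "g \<in> F" for g
      using that by (auto simp: eq_commute agree_def)
    then have "ideal_different N \<Theta> (insert k F)"
      using F(2) unfolding ideal_different_def by auto
    then show False using max[of "insert k F"] F(1) that by blast
  qed
  then show ?thesis using F by blast
qed

section \<open>From a failing cover to a large pairwise different family\<close>

context strong_limit_singular
begin

text \<open>Otherwise maximal different families, one for each proper ideal on
  \<open>\<Theta>\<close>, have together at most |A| members and can be tested as a cover. A
  function \<open>k\<close> that they fail to cover defines a proper ideal, and maximality for this
  very ideal is violated.\<close>

lemma no_cover_imp_different: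
  assumes A: "|M| \<le>o |A|" and K: "infinite K" and no: "\<not> pointwise_cover M A K"
  shows "\<exists>\<Theta> N F. |\<Theta>| <o |M| \<and> complete_ideal K N \<and> \<Theta> \<notin> N \<and> (\<forall>g\<in>F. g ` \<Theta> \<subseteq> A) \<and>
           ideal_different N \<Theta> F \<and> |A| <o |F|" (is ?concl)
proof (rule ccontr)
  assume neg: "\<not> ?thesis"
  have infA: "infinite A" using A infinite_M card_of_ordLeq_finite by blast
  obtain \<Theta> :: "'a set" where \<Theta>: "|\<Theta>| <o |M|"
    and noH': "\<not> (\<exists>H::('a \<Rightarrow> 'a) set. |H| \<le>o |A| \<and> (\<forall>k. k ` \<Theta> \<subseteq> A \<longrightarrow>
        (\<exists>C\<subseteq>H. |C| \<le>o |K| \<and> covers C \<Theta> k)))"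
    using no unfolding pointwise_cover_def by (simp only: not_all not_imp) (elim exE conjE)
  have noH: "\<exists>k. k ` \<Theta> \<subseteq> A \<and> \<not> (\<exists>C\<subseteq>H. |C| \<le>o |K| \<and> covers C \<Theta> k)"
    if "|H| \<le>o |A|" for H :: "('a \<Rightarrow> 'a) set"
    using noH' that by (simp del: not_ex) (metis (no_types))
  \<comment> \<open>Taking ideals inside \<open>Pow \<Theta>\<close> keeps their number below |M|,
    by the strong limit property applied twice.\<close>
  define \<N> where "\<N> = {N\<in>Pow (Pow \<Theta>). complete_ideal K N \<and> \<Theta> \<notin> N}"
  define U where "U = {k. k ` \<Theta> \<subseteq> A}"
  obtain F where F: "\<And>N. F N \<subseteq> U \<and> ideal_different N \<Theta> (F N) \<and>
     (\<forall>k\<in>U. k \<notin> F N \<longrightarrow> (\<exists>g\<in>F N. agree g k \<Theta> \<notin> N))"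
    using ex_maximal_different[of U _ \<Theta>] by metis
  have "|F N| \<le>o |A|" if "N \<in> \<N>" for N
  proof (rule ccontr)
    assume "\<not> ?thesis"
    then have "|A| <o |F N|" by (simp add: not_card_le)
    moreover have "complete_ideal K N" "\<Theta> \<notin> N" using that unfolding \<N>_def by auto
    moreover have "\<forall>g\<in>F N. g ` \<Theta> \<subseteq> A" "ideal_different N \<Theta> (F N)"
      using F[of N] unfolding U_def by auto
    ultimately have ?concl using \<Theta>
      by (intro exI[of _ \<Theta>] exI[of _ N] exI[of _ "F N"] conjI)
    then show False using neg by (rule notE[rotated])
  qed
  moreover have "|\<N>| \<le>o |A|"
  proof -
    have "|\<N>| \<le>o |Pow (Pow \<Theta>)|" unfolding \<N>_def by (rule card_of_mono1) blast
    also have "|Pow (Pow \<Theta>)| <o |M|" using small_Pow[OF small_Pow[OF \<Theta>]] .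
    finally show ?thesis by (rule ordLess_imp_ordLeq[OF ordLess_ordLeq_trans[OF _ A]])
  qed
  ultimately have "|\<Union>N\<in>\<N>. F N| \<le>o |A|"
    by (intro card_of_UNION_ordLeq_infinite[OF infA]) auto
  then obtain k where k: "k ` \<Theta> \<subseteq> A"
    and nok: "\<not> (\<exists>C\<subseteq>(\<Union>N\<in>\<N>. F N). |C| \<le>o |K| \<and> covers C \<Theta> k)"
    using noH by blast
  \<comment> \<open>The parts of \<open>\<Theta>\<close> on which |K| of the collected functions
    suffice for \<open>k\<close>. Infinite \<open>K\<close> makes this ideal complete, and the
    choice of \<open>k\<close> makes it proper.\<close>
  define N where "N = {B. B \<subseteq> \<Theta> \<and> (\<exists>C\<subseteq>(\<Union>N\<in>\<N>. F N). |C| \<le>o |K| \<and> covers C B k)}"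
  have N_sub: "N \<subseteq> Pow \<Theta>" unfolding N_def by blast
  have N_I: "B \<in> N" if "C \<subseteq> (\<Union>N\<in>\<N>. F N)" "|C| \<le>o |K|" "covers C B k" "B \<subseteq> \<Theta>" for B C
    unfolding N_def using that by (intro CollectI conjI exI[of _ C])
  have "complete_ideal K N"
    unfolding complete_ideal_def
  proof (intro conjI ballI allI impI)
    fix X Y assume X: "X \<in> N" and Y: "Y \<subseteq> X"
    from X obtain C where "C \<subseteq> (\<Union>N\<in>\<N>. F N)" "|C| \<le>o |K|" "covers C X k" "X \<subseteq> \<Theta>"
      unfolding N_def by auto
    then show "Y \<in> N" using covers_subset[OF _ Y] Y by (intro N_I[of C]) auto
  next
    fix \<C> assume C: "\<C> \<subseteq> N" "|\<C>| \<le>o |K|"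
    have "\<forall>B\<in>\<C>. \<exists>C. C \<subseteq> (\<Union>N\<in>\<N>. F N) \<and> |C| \<le>o |K| \<and> covers C B k"
      using C(1) unfolding N_def by blast
    then obtain D where D: "\<forall>B\<in>\<C>. D B \<subseteq> (\<Union>N\<in>\<N>. F N) \<and> |D B| \<le>o |K| \<and>
       covers (D B) B k" by (auto dest: bchoice)
    have "|\<Union>B\<in>\<C>. D B| \<le>o |K|"
      using C D by (intro card_of_UNION_ordLeq_infinite[OF K]) auto
    moreover have "(\<Union>B\<in>\<C>. D B) \<subseteq> (\<Union>N\<in>\<N>. F N)" using D by blast
    moreover have "covers (\<Union>B\<in>\<C>. D B) (\<Union>\<C>) k" using D by (intro covers_UNION) simp
    moreover have "\<Union>\<C> \<subseteq> \<Theta>" using C unfolding N_def by blast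
    ultimately show "\<Union>\<C> \<in> N" by (intro N_I)
  qed
  moreover have "\<Theta> \<notin> N" using nok unfolding N_def by simp
  ultimately have N: "N \<in> \<N>" unfolding \<N>_def using N_sub by (intro CollectI conjI) auto
  \<comment> \<open>One function covers the set where it agrees with \<open>k\<close>, so no member
    of \<open>F N\<close> agrees with \<open>k\<close> on a positive set. Then \<open>k\<close> can
    be neither inside \<open>F N\<close>, by properness, nor outside, by maximality.\<close>
  have ag: "agree g k \<Theta> \<in> N" if "g \<in> F N" for g
  proof -
    have "|{g}| \<le>o |K|" using K by (intro card_of_singl_ordLeq) auto
    moreover have "{g} \<subseteq> (\<Union>N\<in>\<N>. F N)" using that N by (intro subsetI UN_I[of N]) auto
    moreover have "agree g k \<Theta> \<subseteq> \<Theta>" unfolding agree_def by blast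
    ultimately show ?thesis using covers_agree by (intro N_I[of "{g}"])
  qed
  have "k \<in> U" using k unfolding U_def by simp
  show False
  proof (cases "k \<in> F N")
    case True
    then show False using ag[OF True] \<open>\<Theta> \<notin> N\<close> by (simp add: agree_def)
  next
    case False
    then obtain g where "g \<in> F N" "agree g k \<Theta> \<notin> N" using F[of N] \<open>k \<in> U\<close> by auto
    then show False using ag by simp
  qed
qed

end

subsection \<open>Large families of pairwise different functions\<close>

abbreviation succ_index :: "'a set \<Rightarrow> 'a set set" where
  "succ_index A \<equiv> Field (cardSuc |A| )"

lemma succ_index_iso: "|succ_index A| =o cardSuc |A|"
  by (rule card_of_Field_ordIso[OF cardSuc_Card_order[OF card_of_Card_order]])

lemma succ_index_greater: "|A| <o |succ_index A|"
  by (rule ordLess_ordIso_trans[OF cardSuc_greater[OF card_of_Card_order] ordIso_symmetric[OF succ_index_iso]])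

lemma succ_index_least:
  assumes "|A| <o |I|" shows "|succ_index A| \<le>o |I|"
  by (rule ordIso_ordLeq_trans[OF succ_index_iso cardSuc_least[OF card_of_Card_order card_of_Card_order assms]])

lemma card_big_diff:
  assumes "infinite A" "|A| <o |L|" "|L - L'| \<le>o |A|" "L' \<subseteq> L"
  shows "|A| <o |L'|"
proof (rule ccontr)
  assume "\<not> ?thesis"
  then have "|L'| \<le>o |A|" using not_card_le by blast
  then have "|L' \<union> (L - L')| \<le>o |A|"
    using assms(1,3)
    by (intro card_of_Un_ordLeq_infinite_Field) (simp_all add: Field_card_of card_of_card_order_on)
  moreover have "L' \<union> (L - L') = L" using assms(4) by blast
  ultimately show False using assms(2) not_card_le[of L A] by simp
qed

lemma card_less_nonempty:
  assumes "|A| <o |L|" shows "L \<noteq> {}"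
proof
  assume "L = {}"
  then have "|L| \<le>o |A|" by (simp add: card_of_empty)
  then show False using assms not_card_le by blast
qed

section \<open>Order facts for the well-order \<open>|A|\<close>\<close>

lemma card_of_trans: "(a, b) \<in> |A| \<Longrightarrow> (b, c) \<in> |A| \<Longrightarrow> (a, c) \<in> |A|"
  using card_of_well_order_on[of A]
  unfolding well_order_on_def linear_order_on_def partial_order_on_def preorder_on_def
  by (meson transD)

lemma card_of_refl_on: "a \<in> A \<Longrightarrow> (a, a) \<in> |A|"
  using card_of_well_order_on[of A]
  unfolding well_order_on_def linear_order_on_def partial_order_on_def preorder_on_def
  by (meson refl_onD)

lemma card_of_total: "a \<in> A \<Longrightarrow> b \<in> A \<Longrightarrow> (a, b) \<in> |A| \<or> (b, a) \<in> |A|"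
  using card_of_well_order_on[of A] card_of_refl_on[of a A]
  unfolding well_order_on_def linear_order_on_def total_on_def by metis

lemma card_of_in: "(a, b) \<in> |A| \<Longrightarrow> a \<in> A" "(a, b) \<in> |A| \<Longrightarrow> b \<in> A"
  using Field_card_of[of A] FieldI1 FieldI2 by fastforce+

lemma agree_mono: "B' \<subseteq> B \<Longrightarrow> agree g h B' \<subseteq> agree g h B"
  unfolding agree_def by blast

lemma ideal_empty:
  assumes "complete_ideal K N" shows "{} \<in> N"
proof -
  have "(\<Union>i\<in>({} :: 'a set set). i) \<in> N" by (rule ideal_UNION[OF assms card_of_empty]) simp
  then show ?thesis by simp
qed

text \<open>Shelah's \<open>T\<^sub>N(f) > |A|\<close>, for the ideal \<open>N\<close> restricted to \<open>B\<close>. Since the families share the index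
  set \<open>|A|\<^sup>+\<close>, families living on disjoint sets can be glued.\<close>

definition big :: "'a set \<Rightarrow> 'a set set \<Rightarrow> 'a set \<Rightarrow> ('a \<Rightarrow> 'a) \<Rightarrow> bool" where
  "big A N B f \<longleftrightarrow> (\<exists>\<psi>. (\<forall>i\<in>succ_index A. \<forall>\<epsilon>\<in>B. (\<psi> i \<epsilon>, f \<epsilon>) \<in> |A| ) \<and>
     (\<forall>i\<in>succ_index A. \<forall>j\<in>succ_index A. i \<noteq> j \<longrightarrow> agree (\<psi> i) (\<psi> j) B \<in> N))"

text \<open>The injection \<open>e\<close> reduces any index set larger than |A| to the one fixed in
  \<open>big\<close>.\<close>

lemma bigI:
  assumes I: "|A| <o |I|" and le: "\<And>i \<epsilon>. i \<in> I \<Longrightarrow> \<epsilon> \<in> B \<Longrightarrow> (\<psi> i \<epsilon>, f \<epsilon>) \<in> |A|"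
    and diff: "\<And>i j. i \<in> I \<Longrightarrow> j \<in> I \<Longrightarrow> i \<noteq> j \<Longrightarrow> agree (\<psi> i) (\<psi> j) B \<in> N"
  shows "big A N B f"
proof -
  obtain e where e: "inj_on e (succ_index A)" "e ` succ_index A \<subseteq> I"
    using iffD2[OF card_of_ordLeq succ_index_least[OF I]] by auto
  show ?thesis unfolding big_def
  proof (intro exI[of _ "\<lambda>i. \<psi> (e i)"] conjI ballI impI)
    fix i \<epsilon> assume "i \<in> succ_index A" "\<epsilon> \<in> B"
    then show "(\<psi> (e i) \<epsilon>, f \<epsilon>) \<in> |A|" using e by (intro le) auto
  next
    fix i j assume "i \<in> succ_index A" "j \<in> succ_index A" "i \<noteq> j"
    then show "agree (\<psi> (e i)) (\<psi> (e j)) B \<in> N"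
      using e by (intro diff) (auto dest: inj_onD)
  qed
qed

lemma bigE:
  assumes "big A N B f"
  obtains \<psi> where "\<And>i \<epsilon>. i \<in> succ_index A \<Longrightarrow> \<epsilon> \<in> B \<Longrightarrow> (\<psi> i \<epsilon>, f \<epsilon>) \<in> |A|"
    "\<And>i j. i \<in> succ_index A \<Longrightarrow> j \<in> succ_index A \<Longrightarrow> i \<noteq> j \<Longrightarrow> agree (\<psi> i) (\<psi> j) B \<in> N"
proof -
  from assms[unfolded big_def] obtain \<psi> where
    *: "(\<forall>i\<in>succ_index A. \<forall>\<epsilon>\<in>B. (\<psi> i \<epsilon>, f \<epsilon>) \<in> |A| ) \<and>
     (\<forall>i\<in>succ_index A. \<forall>j\<in>succ_index A. i \<noteq> j \<longrightarrow> agree (\<psi> i) (\<psi> j) B \<in> N)"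
    by (elim exE)
  show thesis by (rule that[of \<psi>]) (use * in simp_all)
qed

text \<open>Measures the failure of minimality of \<open>f\<close>: on a set outside this ideal,
  \<open>f\<close> cannot be lowered. Casting minimality as an ideal makes positive sets and
  completeness available for it.\<close>

definition drop_ideal :: "'a set \<Rightarrow> 'a set set \<Rightarrow> ('a \<Rightarrow> 'a) \<Rightarrow> 'a set set" where
  "drop_ideal A N f = {C. \<exists>f'. (\<forall>\<epsilon>\<in>C. (f' \<epsilon>, f \<epsilon>) \<in> |A| ) \<and> agree f' f C \<in> N \<and> big A N C f'}"

lemma drop_idealI:
  assumes "\<And>\<epsilon>. \<epsilon> \<in> C \<Longrightarrow> (f' \<epsilon>, f \<epsilon>) \<in> |A|" "agree f' f C \<in> N" "big A N C f'"
  shows "C \<in> drop_ideal A N f"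
  unfolding drop_ideal_def using assms by (intro CollectI exI[of _ f'] conjI ballI)

text \<open>Bounds and families on the members of \<open>\<C>\<close> are glued pointwise. Each
  exceptional set of the glued functions lies in the union of the at most |K| old ones, hence in
  \<open>N\<close>.\<close>

lemma complete_drop_ideal:
  assumes N: "complete_ideal K N"
  shows "complete_ideal K (drop_ideal A N f)"
  unfolding complete_ideal_def
proof (intro conjI ballI allI impI)
  fix C D assume C: "C \<in> drop_ideal A N f" and D: "D \<subseteq> C"
  from C obtain f' where f': "\<forall>\<epsilon>\<in>C. (f' \<epsilon>, f \<epsilon>) \<in> |A|" "agree f' f C \<in> N" "big A N C f'"
    unfolding drop_ideal_def by auto
  from f'(3) obtain \<psi> where \<psi>: "\<And>i \<epsilon>. i \<in> succ_index A \<Longrightarrow> \<epsilon> \<in> C \<Longrightarrow> (\<psi> i \<epsilon>, f' \<epsilon>) \<in> |A|"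
    "\<And>i j. i \<in> succ_index A \<Longrightarrow> j \<in> succ_index A \<Longrightarrow> i \<noteq> j \<Longrightarrow> agree (\<psi> i) (\<psi> j) C \<in> N"
    by (rule bigE) blast
  show "D \<in> drop_ideal A N f"
  proof (rule drop_idealI)
    show "(f' \<epsilon>, f \<epsilon>) \<in> |A|" if "\<epsilon> \<in> D" for \<epsilon> using f'(1) D that by auto
    show "agree f' f D \<in> N" by (rule ideal_subset[OF N f'(2) agree_mono[OF D]])
    show "big A N D f'"
    proof (rule bigI[OF succ_index_greater])
      show "(\<psi> i \<epsilon>, f' \<epsilon>) \<in> |A|" if "i \<in> succ_index A" "\<epsilon> \<in> D" for i \<epsilon>
        using \<psi>(1) D that by auto
      show "agree (\<psi> i) (\<psi> j) D \<in> N" if "i \<in> succ_index A" "j \<in> succ_index A" "i \<noteq> j" for i j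
        by (rule ideal_subset[OF N \<psi>(2)[OF that] agree_mono[OF D]])
    qed
  qed
next
  fix \<C> assume C: "\<C> \<subseteq> drop_ideal A N f" and card: "|\<C>| \<le>o |K|"
  define Q where "Q C f' \<psi> \<longleftrightarrow> (\<forall>\<epsilon>\<in>C. (f' \<epsilon>, f \<epsilon>) \<in> |A| ) \<and> agree f' f C \<in> N \<and>
     (\<forall>i\<in>succ_index A. \<forall>\<epsilon>\<in>C. (\<psi> i \<epsilon>, f' \<epsilon>) \<in> |A| ) \<and>
     (\<forall>i\<in>succ_index A. \<forall>j\<in>succ_index A. i \<noteq> j \<longrightarrow> agree (\<psi> i) (\<psi> j) C \<in> N)" for C f' \<psi>
  have "\<forall>C\<in>\<C>. \<exists>f' \<psi>. Q C f' \<psi>"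
    using C unfolding drop_ideal_def big_def Q_def by auto
  then obtain F where "\<forall>C\<in>\<C>. \<exists>\<psi>. Q C (F C) \<psi>" by (auto dest: bchoice)
  then obtain \<Psi> where Q: "\<forall>C\<in>\<C>. Q C (F C) (\<Psi> C)" by (auto dest: bchoice)
  have "\<forall>\<epsilon>\<in>\<Union>\<C>. \<exists>C. C \<in> \<C> \<and> \<epsilon> \<in> C" by blast
  \<comment> \<open>\<open>c\<close> sends a point to one member of \<open>\<C>\<close> containing
    it, whose bound and family are used at that point.\<close>
  then obtain c where c: "\<forall>\<epsilon>\<in>\<Union>\<C>. c \<epsilon> \<in> \<C> \<and> \<epsilon> \<in> c \<epsilon>" by (rule exE[OF bchoice])
  define f' where "f' = (\<lambda>\<epsilon>. F (c \<epsilon>) \<epsilon>)"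
  define \<psi> where "\<psi> = (\<lambda>i \<epsilon>. \<Psi> (c \<epsilon>) i \<epsilon>)"
  show "\<Union>\<C> \<in> drop_ideal A N f"
  proof (rule drop_idealI)
    show "(f' \<epsilon>, f \<epsilon>) \<in> |A|" if "\<epsilon> \<in> \<Union>\<C>" for \<epsilon>
      using c Q that unfolding Q_def f'_def by auto
    have "(\<Union>C\<in>\<C>. agree (F C) f C) \<in> N"
      using Q by (intro ideal_UNION[OF N card]) (auto simp: Q_def)
    moreover have "agree f' f (\<Union>\<C>) \<subseteq> (\<Union>C\<in>\<C>. agree (F C) f C)"
      using c unfolding agree_def f'_def by fastforce
    ultimately show "agree f' f (\<Union>\<C>) \<in> N" by (rule ideal_subset[OF N])
    show "big A N (\<Union>\<C>) f'"
    proof (rule bigI[OF succ_index_greater])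
      show "(\<psi> i \<epsilon>, f' \<epsilon>) \<in> |A|" if "i \<in> succ_index A" "\<epsilon> \<in> \<Union>\<C>" for i \<epsilon>
        using c Q that unfolding Q_def f'_def \<psi>_def by auto
      fix i j assume ij: "i \<in> succ_index A" "j \<in> succ_index A" "i \<noteq> j"
      have "(\<Union>C\<in>\<C>. agree (\<Psi> C i) (\<Psi> C j) C) \<in> N"
        using Q ij by (intro ideal_UNION[OF N card]) (auto simp: Q_def)
      moreover have "agree (\<psi> i) (\<psi> j) (\<Union>\<C>) \<subseteq> (\<Union>C\<in>\<C>. agree (\<Psi> C i) (\<Psi> C j) C)"
        using c unfolding agree_def \<psi>_def by fastforce
      ultimately show "agree (\<psi> i) (\<psi> j) (\<Union>\<C>) \<in> N" by (rule ideal_subset[OF N])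
    qed
  qed
qed

text \<open>Infinite \<open>K\<close> gives countable completeness. Some point of the positive set
  \<open>B\<close> avoids the countably many exceptional sets of a descending chain, and the values
  there descend strictly in the well-order of \<open>A\<close>.\<close>

lemma wf_ideal_descent:
  assumes N: "complete_ideal K N" and K: "infinite K" and B: "B \<notin> N"
  shows "wf {(f', f). (\<forall>\<epsilon>\<in>B. (f' \<epsilon>, f \<epsilon>) \<in> |A| ) \<and> agree f' f B \<in> N}"
  unfolding wf_iff_no_infinite_down_chain
proof
  assume "\<exists>f. \<forall>n. (f (Suc n), f n) \<in> {(f', f). (\<forall>\<epsilon>\<in>B. (f' \<epsilon>, f \<epsilon>) \<in> |A| ) \<and> agree f' f B \<in> N}"
  then obtain f where f: "\<And>n \<epsilon>. \<epsilon> \<in> B \<Longrightarrow> (f (Suc n) \<epsilon>, f n \<epsilon>) \<in> |A|"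
    "\<And>n. agree (f (Suc n)) (f n) B \<in> N" by auto
  have "(\<Union>n\<in>(UNIV :: nat set). agree (f (Suc n)) (f n) B) \<in> N"
    using K f(2) by (intro ideal_UNION[OF N]) (auto simp: infinite_iff_card_of_nat[symmetric])
  then have "\<not> B \<subseteq> (\<Union>n. agree (f (Suc n)) (f n) B)"
    using B ideal_subset[OF N] by blast
  then obtain \<epsilon> where "\<epsilon> \<in> B" "\<And>n. f (Suc n) \<epsilon> \<noteq> f n \<epsilon>" unfolding agree_def by auto
  then have "\<forall>n. (f (Suc n) \<epsilon>, f n \<epsilon>) \<in> |A| - Id" using f(1) by auto
  moreover have "wf ( |A| - Id)"
    using card_of_well_order_on[of A] unfolding well_order_on_def by blast
  ultimately show False unfolding wf_iff_no_infinite_down_chain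
    by (elim notE) (rule exI[of _ "\<lambda>n. f n \<epsilon>"])
qed

lemma ex_minimal_big:
  assumes N: "complete_ideal K N" and K: "infinite K" and B: "B \<notin> N" and f0: "big A N B f0"
  shows "\<exists>f. big A N B f \<and> B \<notin> drop_ideal A N f"
proof (rule wfE_min[OF wf_ideal_descent[OF N K B], of f0 "{f. big A N B f}"])
  show "f0 \<in> {f. big A N B f}" using f0 by simp
  fix f assume f: "f \<in> {f. big A N B f}"
    and min: "\<And>f'. (f', f) \<in> {(f', f). (\<forall>\<epsilon>\<in>B. (f' \<epsilon>, f \<epsilon>) \<in> |A| ) \<and> agree f' f B \<in> N} \<Longrightarrow> f' \<notin> {f. big A N B f}"
  have "B \<notin> drop_ideal A N f"
  proof
    assume "B \<in> drop_ideal A N f"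
    then obtain f' where "\<forall>\<epsilon>\<in>B. (f' \<epsilon>, f \<epsilon>) \<in> |A|" "agree f' f B \<in> N" "big A N B f'"
      unfolding drop_ideal_def by auto
    then show False using min[of f'] by simp
  qed
  then show ?thesis using f by auto
qed

section \<open>Constant bounds, and the interchange of two ideals\<close>

context strong_limit_singular
begin

text \<open>By completeness, every function of a different family is bounded on a positive set by
  one point of the cofinal \<open>X\<close>. As there are fewer than |M| pairs of a point and a
  subset of \<open>\<Theta>\<close>, more than |A| functions share both.\<close>

lemma no_cover_imp_big:
  assumes A: "|M| \<le>o |A|" and K: "infinite K" and no: "\<not> pointwise_cover M A K"
    and X: "|X| \<le>o |K|" "|X| <o |M|" and cof: "\<forall>a\<in>A. \<exists>x\<in>X. (a, x) \<in> |A|"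
  shows "\<exists>B N x. |B| <o |M| \<and> complete_ideal K N \<and> B \<notin> N \<and> big A N B (\<lambda>_. x)"
proof -
  have infA: "infinite A" using A infinite_M card_of_ordLeq_finite by blast
  obtain \<Theta> N F where \<Theta>: "|\<Theta>| <o |M|" and N: "complete_ideal K N" "\<Theta> \<notin> N"
    and F: "\<forall>g\<in>F. g ` \<Theta> \<subseteq> A" "ideal_different N \<Theta> F" "|A| <o |F|"
    using no_cover_imp_different[OF A K no] by (elim exE conjE)
  have "\<forall>a\<in>A. \<exists>x. x \<in> X \<and> (a, x) \<in> |A|" using cof by auto
  then obtain c where c: "\<forall>a\<in>A. c a \<in> X \<and> (a, c a) \<in> |A|" by (auto dest: bchoice)
  have "\<forall>g\<in>F. \<exists>x. x \<in> X \<and> {\<zeta>\<in>\<Theta>. c (g \<zeta>) = x} \<notin> N"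
  proof
    fix g assume g: "g \<in> F"
    have "(\<lambda>\<zeta>. c (g \<zeta>)) ` \<Theta> \<subseteq> X" using F(1) g c by auto
    from ideal_piece[OF N this X(1)] show "\<exists>x. x \<in> X \<and> {\<zeta>\<in>\<Theta>. c (g \<zeta>) = x} \<notin> N" by auto
  qed
  then obtain x where x: "\<forall>g\<in>F. x g \<in> X \<and> {\<zeta>\<in>\<Theta>. c (g \<zeta>) = x g} \<notin> N" by (auto dest: bchoice)
  define p where "p g = (x g, {\<zeta>\<in>\<Theta>. c (g \<zeta>) = x g})" for g
  have sub: "p ` F \<subseteq> X \<times> Pow \<Theta>" using x unfolding p_def by auto
  have "|X \<times> Pow \<Theta>| \<le>o |A|"
    by (rule ordLess_imp_ordLeq[OF ordLess_ordLeq_trans[OF small_Times[OF X(2) small_Pow[OF \<Theta>]] A]])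
  from pigeonhole_card[OF infA F(3) sub this]
  obtain t where t: "|A| <o |{g\<in>F. p g = t}|" by (rule bexE)
  obtain y B where yB: "t = (y, B)" by (cases t)
  obtain g where g: "g \<in> F" "p g = t" using card_less_nonempty[OF t] by auto
  have "B \<notin> N" "B \<subseteq> \<Theta>" using g x yB unfolding p_def by auto
  have "|B| <o |M|" by (rule ordLeq_ordLess_trans[OF card_of_mono1[OF \<open>B \<subseteq> \<Theta>\<close>] \<Theta>])
  moreover have "big A N B (\<lambda>_. y)"
  proof (rule bigI[OF t, where \<psi>="\<lambda>g. g"])
    show "(g \<epsilon>, y) \<in> |A|" if "g \<in> {g\<in>F. p g = t}" "\<epsilon> \<in> B" for g \<epsilon>
    proof -
      have "g \<epsilon> \<in> A" using that F(1) \<open>B \<subseteq> \<Theta>\<close> by auto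
      then have "(g \<epsilon>, c (g \<epsilon>)) \<in> |A|" using c by simp
      moreover have "c (g \<epsilon>) = y" using that yB unfolding p_def by auto
      ultimately show ?thesis by simp
    qed
    show "agree g h B \<in> N" if "g \<in> {g\<in>F. p g = t}" "h \<in> {g\<in>F. p g = t}" "g \<noteq> h" for g h
    proof -
      have "agree g h \<Theta> \<in> N" using that F(2) unfolding ideal_different_def by auto
      then show ?thesis by (rule ideal_subset[OF N(1) _ agree_mono[OF \<open>B \<subseteq> \<Theta>\<close>]])
    qed
  qed
  ultimately show ?thesis using N \<open>B \<notin> N\<close> by (intro exI conjI)
qed

text \<open>Interchanging \<open>N\<close> and \<open>N1\<close>: each \<open>\<zeta> \<mapsto> \<chi> (\<gamma> l \<zeta>) \<epsilon>\<close> is covered by few functions from a family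
  that embeds into the ordinal \<open>g \<epsilon>\<close>, and by the completeness of \<open>N1\<close> one choice function \<open>h l\<close> picks
  the right one for all \<open>\<epsilon>\<close> simultaneously on an \<open>N1\<close>-positive set.\<close>

lemma big_commute:
  assumes infA: "infinite A" and B1: "|B1| <o |M|" "|Pow B1| \<le>o |A|"
    and N: "complete_ideal K N" and N1: "complete_ideal K1 N1" "B1 \<notin> N1" "big A N1 B1 (\<lambda>_. x1)"
    and \<chi>: "\<And>y \<epsilon>. y \<in> under |A| x1 \<Longrightarrow> \<epsilon> \<in> C \<Longrightarrow> (\<chi> y \<epsilon>, g \<epsilon>) \<in> |A|"
    and \<chi>_diff: "\<And>y z. y \<in> under |A| x1 \<Longrightarrow> z \<in> under |A| x1 \<Longrightarrow> y \<noteq> z \<Longrightarrow> agree (\<chi> y) (\<chi> z) C \<in> N"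
    and cov: "\<And>\<epsilon>. \<epsilon> \<in> C \<Longrightarrow> pointwise_cover M (under |A| (g \<epsilon>)) K'"
    and K1: "|Pow (C \<times> (C \<times> K'))| \<le>o |K1|"
  shows "big A N C g"
proof -
  \<comment> \<open>Each \<open>\<gamma> l\<close> will give rise to one new function below
    \<open>g\<close>.\<close>
  obtain \<gamma> where \<gamma>: "\<And>l \<zeta>. l \<in> succ_index A \<Longrightarrow> \<zeta> \<in> B1 \<Longrightarrow> (\<gamma> l \<zeta>, x1) \<in> |A|"
    and \<gamma>_diff: "\<And>l m. l \<in> succ_index A \<Longrightarrow> m \<in> succ_index A \<Longrightarrow> l \<noteq> m \<Longrightarrow> agree (\<gamma> l) (\<gamma> m) B1 \<in> N1"
    using N1(3) by (rule bigE) blast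
  have under: "\<gamma> l \<zeta> \<in> under |A| x1" if "l \<in> succ_index A" "\<zeta> \<in> B1" for l \<zeta>
    using \<gamma>[OF that] by (simp add: under_def)
  define Q where "Q \<epsilon> H \<longleftrightarrow> |H| \<le>o |under |A| (g \<epsilon>)| \<and>
     (\<forall>k. k ` B1 \<subseteq> under |A| (g \<epsilon>) \<longrightarrow> (\<exists>D\<subseteq>H. |D| \<le>o |K'| \<and> covers D B1 k))"
     for \<epsilon> and H :: "('a \<Rightarrow> 'a) set"
  have "\<forall>\<epsilon>\<in>C. \<exists>H. Q \<epsilon> H"
  proof
    fix \<epsilon> assume "\<epsilon> \<in> C"
    obtain H :: "('a \<Rightarrow> 'a) set" where "|H| \<le>o |under |A| (g \<epsilon>)|"
     "\<forall>k. k ` B1 \<subseteq> under |A| (g \<epsilon>) \<longrightarrow> (\<exists>D\<subseteq>H. |D| \<le>o |K'| \<and> covers D B1 k)"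
      by (rule pointwise_coverE[OF cov[OF \<open>\<epsilon> \<in> C\<close>] B1(1)])
    then show "\<exists>H. Q \<epsilon> H" unfolding Q_def by (intro exI[of _ H] conjI)
  qed
  then obtain H where H: "\<forall>\<epsilon>\<in>C. Q \<epsilon> (H \<epsilon>)" by (auto dest: bchoice)
  have "\<forall>\<epsilon>\<in>C. \<exists>b. inj_on b (H \<epsilon>) \<and> b ` H \<epsilon> \<subseteq> under |A| (g \<epsilon>)"
  proof
    fix \<epsilon> assume "\<epsilon> \<in> C"
    then have "|H \<epsilon>| \<le>o |under |A| (g \<epsilon>)|" using H unfolding Q_def by simp
    then show "\<exists>b. inj_on b (H \<epsilon>) \<and> b ` H \<epsilon> \<subseteq> under |A| (g \<epsilon>)" by (rule iffD2[OF card_of_ordLeq])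
  qed
  then obtain b where b: "\<forall>\<epsilon>\<in>C. inj_on (b \<epsilon>) (H \<epsilon>) \<and> b \<epsilon> ` H \<epsilon> \<subseteq> under |A| (g \<epsilon>)"
    by (auto dest: bchoice)
  \<comment> \<open>The points at which a single choice \<open>h\<close> of covering functions is
    right for all \<open>\<epsilon>\<close> at once.\<close>
  define E where "E l h = {\<zeta>\<in>B1. \<forall>\<epsilon>\<in>C. h \<epsilon> \<zeta> = \<chi> (\<gamma> l \<zeta>) \<epsilon>}" for l and h :: "'a \<Rightarrow> 'a \<Rightarrow> 'a"
  have "\<forall>l\<in>succ_index A. \<exists>h. (\<forall>\<epsilon>\<in>C. h \<epsilon> \<in> H \<epsilon>) \<and> E l h \<notin> N1"
  proof
    fix l assume l: "l \<in> succ_index A"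
    have "\<forall>\<epsilon>\<in>C. \<exists>D. D \<subseteq> H \<epsilon> \<and> |D| \<le>o |K'| \<and> covers D B1 (\<lambda>\<zeta>. \<chi> (\<gamma> l \<zeta>) \<epsilon>)"
    proof
      fix \<epsilon> assume \<epsilon>: "\<epsilon> \<in> C"
      have "(\<lambda>\<zeta>. \<chi> (\<gamma> l \<zeta>) \<epsilon>) ` B1 \<subseteq> under |A| (g \<epsilon>)"
        using \<chi>[OF under[OF l] \<epsilon>] by (auto simp: under_def)
      moreover have "Q \<epsilon> (H \<epsilon>)" using H \<epsilon> by simp
      ultimately show "\<exists>D. D \<subseteq> H \<epsilon> \<and> |D| \<le>o |K'| \<and> covers D B1 (\<lambda>\<zeta>. \<chi> (\<gamma> l \<zeta>) \<epsilon>)"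
        unfolding Q_def by (elim conjE allE impE)
    qed
    then obtain D where D: "\<forall>\<epsilon>\<in>C. D \<epsilon> \<subseteq> H \<epsilon> \<and> |D \<epsilon>| \<le>o |K'| \<and> covers (D \<epsilon>) B1 (\<lambda>\<zeta>. \<chi> (\<gamma> l \<zeta>) \<epsilon>)"
      by (auto dest: bchoice)
    define \<eta> where "\<eta> \<zeta> \<epsilon> = (SOME h. h \<in> D \<epsilon> \<and> h \<zeta> = \<chi> (\<gamma> l \<zeta>) \<epsilon>)" for \<zeta> \<epsilon>
    have \<eta>: "\<eta> \<zeta> \<epsilon> \<in> D \<epsilon> \<and> \<eta> \<zeta> \<epsilon> \<zeta> = \<chi> (\<gamma> l \<zeta>) \<epsilon>" if "\<zeta> \<in> B1" "\<epsilon> \<in> C" for \<zeta> \<epsilon>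
    proof -
      have "covers (D \<epsilon>) B1 (\<lambda>\<zeta>. \<chi> (\<gamma> l \<zeta>) \<epsilon>)" using D that(2) by simp
      then have "\<exists>h\<in>D \<epsilon>. h \<zeta> = \<chi> (\<gamma> l \<zeta>) \<epsilon>" unfolding covers_def using that(1) by (rule bspec)
      then have "\<exists>h. h \<in> D \<epsilon> \<and> h \<zeta> = \<chi> (\<gamma> l \<zeta>) \<epsilon>" by (simp add: Bex_def)
      then show ?thesis unfolding \<eta>_def by (rule someI_ex)
    qed
    let ?U = "\<Union>\<epsilon>\<in>C. D \<epsilon>"
    \<comment> \<open>The graph of the choice made at \<open>\<zeta>\<close>, a subset of
      \<open>C \<times> ?U\<close>. By the size of \<open>K1\<close> this graph is constant on an
      \<open>N1\<close>-positive set.\<close>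
    define gr where "gr \<zeta> = (\<lambda>\<epsilon>. (\<epsilon>, \<eta> \<zeta> \<epsilon>)) ` C" for \<zeta>
    have "|?U| \<le>o |C \<times> K'|"
    proof -
      have "|SIGMA \<epsilon>:C. D \<epsilon>| \<le>o |SIGMA \<epsilon>:C. K'|" using D by (intro card_of_Sigma_mono1) auto
      then show ?thesis by (rule ordLeq_transitive[OF card_of_UNION_Sigma])
    qed
    then have PowU: "|Pow (C \<times> ?U)| \<le>o |K1|"
      by (intro ordLeq_transitive[OF card_Pow_mono[OF card_of_Times_mono2] K1])
    have "gr ` B1 \<subseteq> Pow (C \<times> ?U)" using \<eta> unfolding gr_def by auto
    from ideal_piece[OF N1(1,2) this PowU]
    obtain t where t: "{\<zeta>\<in>B1. gr \<zeta> = t} \<notin> N1" by (rule bexE)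
    have "{\<zeta>\<in>B1. gr \<zeta> = t} \<noteq> {}" using t ideal_empty[OF N1(1)] by (intro notI) (simp only: not_True_eq_False)
    then obtain \<zeta>0 where \<zeta>0: "\<zeta>0 \<in> B1" "gr \<zeta>0 = t" by auto
    have "{\<zeta>\<in>B1. gr \<zeta> = t} \<subseteq> E l (\<eta> \<zeta>0)"
    proof
      fix \<zeta> assume z: "\<zeta> \<in> {\<zeta>\<in>B1. gr \<zeta> = t}"
      then have "gr \<zeta> = gr \<zeta>0" using \<zeta>0 by simp
      then have "\<eta> \<zeta> \<epsilon> = \<eta> \<zeta>0 \<epsilon>" if "\<epsilon> \<in> C" for \<epsilon> using that unfolding gr_def by auto
      then show "\<zeta> \<in> E l (\<eta> \<zeta>0)" using z \<eta>[of \<zeta>] unfolding E_def by auto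
    qed
    then have "E l (\<eta> \<zeta>0) \<notin> N1" using t ideal_subset[OF N1(1)] by metis
    moreover have "\<forall>\<epsilon>\<in>C. \<eta> \<zeta>0 \<epsilon> \<in> H \<epsilon>" using \<eta>[OF \<zeta>0(1)] D by auto
    ultimately show "\<exists>h. (\<forall>\<epsilon>\<in>C. h \<epsilon> \<in> H \<epsilon>) \<and> E l h \<notin> N1" by (intro exI conjI)
  qed
  then obtain h where h: "\<forall>l\<in>succ_index A. (\<forall>\<epsilon>\<in>C. h l \<epsilon> \<in> H \<epsilon>) \<and> E l (h l) \<notin> N1"
    by (auto dest: bchoice)
  have "(\<lambda>l. E l (h l)) ` succ_index A \<subseteq> Pow B1" unfolding E_def by auto
  \<comment> \<open>Subsets of \<open>B1\<close> number at most |A|, so one positive set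
    \<open>G\<close> serves more than |A| indices \<open>l\<close>.\<close>
  from pigeonhole_card[OF infA succ_index_greater this B1(2)]
  obtain G where G: "|A| <o |{l\<in>succ_index A. E l (h l) = G}|" by (rule bexE)
  have "G \<notin> N1" using card_less_nonempty[OF G] h by auto
  \<comment> \<open>\<open>b \<epsilon>\<close> codes a covering function as an element not above
    \<open>g \<epsilon>\<close>; being injective, it lets agreement of codes be read as agreement of
    functions.\<close>
  show ?thesis
  proof (rule bigI[OF G, where \<psi>="\<lambda>l \<epsilon>. b \<epsilon> (h l \<epsilon>)"])
    show "(b \<epsilon> (h l \<epsilon>), g \<epsilon>) \<in> |A|" if "l \<in> {l\<in>succ_index A. E l (h l) = G}" "\<epsilon> \<in> C" for l \<epsilon>
    proof -
      have "h l \<epsilon> \<in> H \<epsilon>" "b \<epsilon> ` H \<epsilon> \<subseteq> under |A| (g \<epsilon>)" using that b h by auto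
      then show ?thesis unfolding under_def by auto
    qed
    fix l m assume l: "l \<in> {l\<in>succ_index A. E l (h l) = G}" and m: "m \<in> {l\<in>succ_index A. E l (h l) = G}"
      and "l \<noteq> m"
    show "agree (\<lambda>\<epsilon>. b \<epsilon> (h l \<epsilon>)) (\<lambda>\<epsilon>. b \<epsilon> (h m \<epsilon>)) C \<in> N" (is "?Z \<in> N")
    proof (rule ccontr)
      \<comment> \<open>A positive \<open>?Z\<close> forces \<open>\<gamma> l\<close> and
        \<open>\<gamma> m\<close> to agree at each point of \<open>G\<close>: where they differ,
        \<open>\<chi>_diff\<close> puts into \<open>N\<close> a set containing \<open>?Z\<close>.
        But \<open>G\<close> is \<open>N1\<close>-positive.\<close>
      assume Z: "?Z \<notin> N"
      have heq: "h l \<epsilon> = h m \<epsilon>" if "\<epsilon> \<in> ?Z" for \<epsilon>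
      proof -
        from that have "\<epsilon> \<in> C" "b \<epsilon> (h l \<epsilon>) = b \<epsilon> (h m \<epsilon>)" unfolding agree_def by auto
        moreover have "h l \<epsilon> \<in> H \<epsilon>" "h m \<epsilon> \<in> H \<epsilon>" using h l m \<open>\<epsilon> \<in> C\<close> by simp_all
        moreover have "inj_on (b \<epsilon>) (H \<epsilon>)" using b \<open>\<epsilon> \<in> C\<close> by simp
        ultimately show ?thesis by (simp add: inj_on_eq_iff)
      qed
      have "\<gamma> l \<zeta> = \<gamma> m \<zeta>" if \<zeta>: "\<zeta> \<in> G" for \<zeta>
      proof (rule ccontr)
        assume neq: "\<gamma> l \<zeta> \<noteq> \<gamma> m \<zeta>"
        have E: "\<zeta> \<in> E l (h l)" "\<zeta> \<in> E m (h m)" using l m \<zeta> by auto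
        then have "\<zeta> \<in> B1" unfolding E_def by auto
        have "?Z \<subseteq> agree (\<chi> (\<gamma> l \<zeta>)) (\<chi> (\<gamma> m \<zeta>)) C"
        proof
          fix \<epsilon> assume \<epsilon>: "\<epsilon> \<in> ?Z"
          then have "\<epsilon> \<in> C" unfolding agree_def by auto
          moreover have "\<chi> (\<gamma> l \<zeta>) \<epsilon> = \<chi> (\<gamma> m \<zeta>) \<epsilon>"
            using E \<open>\<epsilon> \<in> C\<close> heq[OF \<epsilon>] unfolding E_def by auto
          ultimately show "\<epsilon> \<in> agree (\<chi> (\<gamma> l \<zeta>)) (\<chi> (\<gamma> m \<zeta>)) C" unfolding agree_def by auto
        qed
        moreover have "agree (\<chi> (\<gamma> l \<zeta>)) (\<chi> (\<gamma> m \<zeta>)) C \<in> N"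
          using l m \<open>\<zeta> \<in> B1\<close> neq by (intro \<chi>_diff under) auto
        ultimately show False using Z ideal_subset[OF N] by metis
      qed
      moreover have "G \<subseteq> B1" using l unfolding E_def by auto
      ultimately have "G \<subseteq> agree (\<gamma> l) (\<gamma> m) B1" unfolding agree_def by auto
      moreover have "agree (\<gamma> l) (\<gamma> m) B1 \<in> N1" using l m \<open>l \<noteq> m\<close> by (intro \<gamma>_diff) auto
      ultimately show False using \<open>G \<notin> N1\<close> ideal_subset[OF N1(1)] by metis
    qed
  qed
qed

end

subsection \<open>The revised GCH\<close>

lemma card_under_less:
  assumes "infinite A" "a \<in> A" shows "|under |A| a| <o |A|"
proof -
  have "|underS |A| a| <o |A|"
    using assms by (intro card_of_underS[OF card_of_Card_order]) (simp add: Field_card_of)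
  moreover have "|{a}| <o |A|" using assms(1) by (intro card_finite_less) simp_all
  ultimately have "|{a} \<union> underS |A| a| <o |A|" by (intro card_of_Un_ordLess_infinite[OF assms(1)])
  moreover have "under |A| a \<subseteq> {a} \<union> underS |A| a" unfolding under_def underS_def by auto
  ultimately show ?thesis by (rule ordLeq_ordLess_trans[OF card_of_mono1, rotated])
qed

text \<open>|A| may be singular, so no fibre need have size |A|; but fibres all of size at most |Y|
  would give |I| \<le> |T \<times> Y| < |A|.\<close>

lemma large_fiber:
  assumes "infinite A" "|I| =o |A|" "f ` I \<subseteq> T" "|T| <o |A|" "|Y| <o |A|"
  shows "\<exists>t\<in>T. |Y| <o |{i\<in>I. f i = t}|"
proof (rule ccontr)
  assume "\<not> ?thesis"
  then have le: "\<forall>t\<in>T. |{i\<in>I. f i = t}| \<le>o |Y|" using not_card_le by blast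
  have "I = (\<Union>t\<in>T. {i\<in>I. f i = t})" using assms(3) by auto
  then have "|I| \<le>o |SIGMA t:T. {i\<in>I. f i = t}|" using card_of_UNION_Sigma[of "\<lambda>t. {i\<in>I. f i = t}" T] by simp
  then have "|I| \<le>o |T \<times> Y|" by (rule ordLeq_transitive[OF _ card_of_Sigma_mono1[OF le]])
  then have "|I| <o |A|" by (rule ordLeq_ordLess_trans[OF _ card_Times_less[OF assms(1,4,5)]])
  then show False using assms(2) not_ordLess_ordIso by blast
qed

context strong_limit_singular
begin

text \<open>Two members that agree with \<open>f\<close> on the same set agree with each other
  there. So the members with positive agreement with \<open>f\<close> have distinct agreement sets,
  all subsets of \<open>B\<close>.\<close>

lemma few_ideal_equal:
  assumes N: "complete_ideal K N" and BA: "|Pow B| \<le>o |A|"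
    and diff: "\<And>i j. i \<in> L \<Longrightarrow> j \<in> L \<Longrightarrow> i \<noteq> j \<Longrightarrow> agree (\<psi> i) (\<psi> j) B \<in> N"
  shows "|L - {i\<in>L. agree (\<psi> i) f B \<in> N}| \<le>o |A|"
proof -
  let ?D = "L - {i\<in>L. agree (\<psi> i) f B \<in> N}"
  have "inj_on (\<lambda>i. agree (\<psi> i) f B) ?D"
  proof (rule inj_onI, rule ccontr)
    fix i j assume i: "i \<in> ?D" and j: "j \<in> ?D" and eq: "agree (\<psi> i) f B = agree (\<psi> j) f B" and "i \<noteq> j"
    have "agree (\<psi> i) f B \<subseteq> agree (\<psi> i) (\<psi> j) B"
    proof
      fix \<epsilon> assume "\<epsilon> \<in> agree (\<psi> i) f B"
      then have "\<epsilon> \<in> agree (\<psi> i) f B" "\<epsilon> \<in> agree (\<psi> j) f B" using eq by simp_all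
      then show "\<epsilon> \<in> agree (\<psi> i) (\<psi> j) B" unfolding agree_def by simp
    qed
    moreover have "agree (\<psi> i) (\<psi> j) B \<in> N" using i j \<open>i \<noteq> j\<close> by (intro diff) simp_all
    ultimately have "agree (\<psi> i) f B \<in> N" by (rule ideal_subset[OF N, rotated])
    then show False using i by simp
  qed
  moreover have "(\<lambda>i. agree (\<psi> i) f B) ` ?D \<subseteq> Pow B" unfolding agree_def by auto
  ultimately have "|?D| \<le>o |Pow B|" by (intro card_of_ordLeqI) auto
  then show ?thesis by (rule ordLeq_transitive[OF _ BA])
qed

text \<open>The order of choices is essential: \<open>K0\<close>, then the minimal \<open>f\<close>
  and its ideal \<open>J\<close>, then a stable cover size \<open>K'\<close>, and only then
  \<open>K1\<close>. Both ideals are available because every member of \<open>\<K>\<close>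
  fails.\<close>

lemma cover_singular_case:
  assumes A: "|M| \<le>o |A|"
    and IH: "\<And>b. b \<in> A \<Longrightarrow> \<exists>K\<in>\<K>. pointwise_cover M (under |A| b) K"
    and X: "X \<subseteq> A" "|X| <o |M|" and cof: "\<forall>a\<in>A. \<exists>x\<in>X. (a, x) \<in> |A|"
  shows "\<exists>K\<in>\<K>. pointwise_cover M A K"
proof (rule ccontr)
  assume no: "\<not> ?thesis"
  have infA: "infinite A" using A infinite_M card_of_ordLeq_finite by blast
  \<comment> \<open>Size |X| is for \<open>no_cover_imp_big\<close>, size |\<K>| for stabilising the
    cover sizes supplied by \<open>IH\<close>.\<close>
  obtain K0 where K0: "K0 \<in> \<K>" "infinite K0" "|X <+> \<K>| \<le>o |K0|"
    using ex_large_\<K>[OF card_of_Plus_ordLess_infinite[OF infinite_M X(2) small_index]] by auto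
  have XK0: "|X| \<le>o |K0|" by (rule ordLeq_transitive[OF card_of_Plus1 K0(3)])
  have \<K>K0: "|\<K>| \<le>o |K0|" by (rule ordLeq_transitive[OF card_of_Plus2 K0(3)])
  have noK0: "\<not> pointwise_cover M A K0" using no K0(1) by auto
  obtain B N x0 where B: "|B| <o |M|" and N: "complete_ideal K0 N" "B \<notin> N"
    and big0: "big A N B (\<lambda>_. x0)"
    using no_cover_imp_big[OF A K0(2) noK0 XK0 X(2) cof] by (elim exE conjE)
  have PowB: "|Pow B| \<le>o |A|"
    by (rule ordLess_imp_ordLeq[OF ordLess_ordLeq_trans[OF small_Pow[OF B] A]])
  obtain f where f: "big A N B f" and BJ: "B \<notin> drop_ideal A N f"
    using ex_minimal_big[OF N(1) K0(2) N(2) big0] by (elim exE conjE)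
  define J where "J = drop_ideal A N f"
  have J: "complete_ideal K0 J" unfolding J_def by (rule complete_drop_ideal[OF N(1)])
  obtain \<psi> where \<psi>: "\<And>i \<epsilon>. i \<in> succ_index A \<Longrightarrow> \<epsilon> \<in> B \<Longrightarrow> (\<psi> i \<epsilon>, f \<epsilon>) \<in> |A|"
    and \<psi>_diff: "\<And>i j. i \<in> succ_index A \<Longrightarrow> j \<in> succ_index A \<Longrightarrow> i \<noteq> j \<Longrightarrow> agree (\<psi> i) (\<psi> j) B \<in> N"
    using f by (rule bigE) blast
  \<comment> \<open>Removing the few members that meet \<open>f\<close> on a positive set leaves
    members strictly below \<open>f\<close> modulo \<open>N\<close>, as lowering \<open>f\<close>
    requires.\<close>
  define L1 where "L1 = {i\<in>succ_index A. agree (\<psi> i) f B \<in> N}"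
  have L1: "|A| <o |L1|" unfolding L1_def
    by (rule card_big_diff[OF infA succ_index_greater few_ideal_equal[OF N(1) PowB \<psi>_diff]]) auto
  have into_J: "C \<in> J" if "i \<in> L1" "C \<subseteq> B" "big A N C (\<psi> i)" for i C
    unfolding J_def
  proof (rule drop_idealI[OF _ _ that(3)])
    show "(\<psi> i \<epsilon>, f \<epsilon>) \<in> |A|" if "\<epsilon> \<in> C" for \<epsilon>
      using \<open>i \<in> L1\<close> \<open>C \<subseteq> B\<close> that by (intro \<psi>) (auto simp: L1_def)
    have "agree (\<psi> i) f B \<in> N" using that(1) unfolding L1_def by simp
    then show "agree (\<psi> i) f C \<in> N" by (rule ideal_subset[OF N(1) _ agree_mono[OF that(2)]])
  qed
  \<comment> \<open>Indices \<open>j\<close> for which \<open>\<psi> j\<close> is not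
    \<open>J\<close>-almost everywhere strictly above \<open>\<psi> i\<close>. More than |A| of them
    would share a positive set on which they do not exceed \<open>\<psi> i\<close>; then
    \<open>\<psi> i\<close> would be big there, against \<open>into_J\<close>.\<close>
  define bad where "bad i = {j\<in>succ_index A. {\<epsilon>\<in>B. (\<psi> j \<epsilon>, \<psi> i \<epsilon>) \<in> |A|} \<notin> J}" for i
  have bad: "|bad i| \<le>o |A|" if i: "i \<in> L1" for i
  proof -
    have "|{j\<in>succ_index A. \<forall>\<epsilon>\<in>C. (\<psi> j \<epsilon>, \<psi> i \<epsilon>) \<in> |A|}| \<le>o |A|" (is "|?S| \<le>o _") if C: "C \<in> Pow B - J" for C
    proof (rule ccontr)
      assume "\<not> ?thesis"
      then have S: "|A| <o |?S|" by (simp only: not_card_le)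
      have "big A N C (\<psi> i)"
      proof (rule bigI[OF S, where \<psi>=\<psi>])
        show "agree (\<psi> j) (\<psi> k) C \<in> N" if "j \<in> ?S" "k \<in> ?S" "j \<noteq> k" for j k
        proof -
          have "agree (\<psi> j) (\<psi> k) B \<in> N" using that by (intro \<psi>_diff) auto
          then show ?thesis by (rule ideal_subset[OF N(1) _ agree_mono]) (use C in auto)
        qed
      qed simp
      then have "C \<in> J" using C by (intro into_J[OF i]) auto
      then show False using C by simp
    qed
    moreover have "|Pow B - J| \<le>o |A|"
      by (rule ordLeq_transitive[OF card_of_mono1 PowB]) auto
    ultimately have "|\<Union>C\<in>Pow B - J. {j\<in>succ_index A. \<forall>\<epsilon>\<in>C. (\<psi> j \<epsilon>, \<psi> i \<epsilon>) \<in> |A|}| \<le>o |A|"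
      by (intro card_of_UNION_ordLeq_infinite[OF infA]) auto
    moreover have "bad i \<subseteq> (\<Union>C\<in>Pow B - J. {j\<in>succ_index A. \<forall>\<epsilon>\<in>C. (\<psi> j \<epsilon>, \<psi> i \<epsilon>) \<in> |A|})"
    proof
      fix j assume "j \<in> bad i"
      then show "j \<in> (\<Union>C\<in>Pow B - J. {j\<in>succ_index A. \<forall>\<epsilon>\<in>C. (\<psi> j \<epsilon>, \<psi> i \<epsilon>) \<in> |A|})"
        unfolding bad_def by (intro UN_I[of "{\<epsilon>\<in>B. (\<psi> j \<epsilon>, \<psi> i \<epsilon>) \<in> |A|}"]) auto
    qed
    ultimately show ?thesis by (rule ordLeq_transitive[OF card_of_mono1, rotated])
  qed
  have "\<forall>b\<in>A. \<exists>K. K \<in> \<K> \<and> pointwise_cover M (under |A| b) K" using IH by auto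
  then obtain \<kappa> where \<kappa>: "\<forall>b\<in>A. \<kappa> b \<in> \<K> \<and> pointwise_cover M (under |A| b) (\<kappa> b)"
    by (rule exE[OF bchoice])
  have \<psi>A: "\<psi> i \<epsilon> \<in> A" if "i \<in> L1" "\<epsilon> \<in> B" for i \<epsilon>
    by (rule card_of_in(1)[OF \<psi>]) (use that L1_def in auto)
  \<comment> \<open>For each \<open>i\<close> the cover size is constant on a
    \<open>J\<close>-positive set. Pigeonholing the pair of size and set gives one \<open>K'\<close>
    and one \<open>C\<close> for all indices in \<open>L2\<close>.\<close>
  have "\<forall>i\<in>L1. \<exists>k. k \<in> \<K> \<and> {\<epsilon>\<in>B. \<kappa> (\<psi> i \<epsilon>) = k} \<notin> J"
  proof
    fix i assume i: "i \<in> L1"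
    have "(\<lambda>\<epsilon>. \<kappa> (\<psi> i \<epsilon>)) ` B \<subseteq> \<K>" using \<kappa> \<psi>A[OF i] by auto
    from ideal_piece[OF J BJ[folded J_def] this \<K>K0]
    show "\<exists>k. k \<in> \<K> \<and> {\<epsilon>\<in>B. \<kappa> (\<psi> i \<epsilon>) = k} \<notin> J" by (simp add: Bex_def)
  qed
  then obtain k where k: "\<forall>i\<in>L1. k i \<in> \<K> \<and> {\<epsilon>\<in>B. \<kappa> (\<psi> i \<epsilon>) = k i} \<notin> J" by (rule exE[OF bchoice])
  define p where "p i = (k i, {\<epsilon>\<in>B. \<kappa> (\<psi> i \<epsilon>) = k i})" for i
  have p_sub: "p ` L1 \<subseteq> \<K> \<times> Pow B" using k unfolding p_def by auto
  have p_card: "|\<K> \<times> Pow B| \<le>o |A|"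
    by (rule ordLess_imp_ordLeq[OF ordLess_ordLeq_trans[OF small_Times[OF small_index small_Pow[OF B]] A]])
  obtain t where t: "|A| <o |{i\<in>L1. p i = t}|"
    using pigeonhole_card[OF infA L1 p_sub p_card] by (rule bexE)
  obtain K' C where KC: "t = (K', C)" by (cases t)
  define L2 where "L2 = {i\<in>L1. p i = t}"
  have L2: "|A| <o |L2|" using t unfolding L2_def .
  have L2D: "i \<in> L1" "k i = K'" "{\<epsilon>\<in>B. \<kappa> (\<psi> i \<epsilon>) = K'} = C" if "i \<in> L2" for i
    using that KC unfolding L2_def p_def by auto
  obtain i0 where i0: "i0 \<in> L2" using card_less_nonempty[OF L2] by auto
  have K': "K' \<in> \<K>" using k L2D(1,2)[OF i0] by auto
  have C: "C \<subseteq> B" "C \<notin> J" using k L2D[OF i0] by auto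
  have cov: "pointwise_cover M (under |A| (\<psi> i \<epsilon>)) K'" if "i \<in> L2" "\<epsilon> \<in> C" for i \<epsilon>
  proof -
    have "\<epsilon> \<in> B" "\<kappa> (\<psi> i \<epsilon>) = K'" using L2D(3)[OF that(1)] that(2) by auto
    then show ?thesis using \<kappa> \<psi>A[OF L2D(1)[OF that(1)]] by auto
  qed
  have W: "|Pow (B \<times> (B \<times> K'))| <o |M|"
    by (intro small_Pow small_Times B small_\<K>[OF K'])
  \<comment> \<open>\<open>K1\<close> has to meet the size premise of \<open>big_commute\<close>,
    which depends on \<open>B\<close> and \<open>K'\<close>; hence the second ideal comes after the
    first.\<close>
  obtain K1 where K1: "K1 \<in> \<K>" "infinite K1" "|X <+> Pow (B \<times> (B \<times> K'))| \<le>o |K1|"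
    using ex_large_\<K>[OF card_of_Plus_ordLess_infinite[OF infinite_M X(2) W]] by auto
  have XK1: "|X| \<le>o |K1|" by (rule ordLeq_transitive[OF card_of_Plus1 K1(3)])
  have WK1: "|Pow (B \<times> (B \<times> K'))| \<le>o |K1|" by (rule ordLeq_transitive[OF card_of_Plus2 K1(3)])
  have noK1: "\<not> pointwise_cover M A K1" using no K1(1) by auto
  obtain B1 N1 x1 where B1: "|B1| <o |M|" and N1: "complete_ideal K1 N1" "B1 \<notin> N1"
    and big1: "big A N1 B1 (\<lambda>_. x1)"
    using no_cover_imp_big[OF A K1(2) noK1 XK1 X(2) cof] by (elim exE conjE)
  have PowB1: "|Pow B1| \<le>o |A|"
    by (rule ordLess_imp_ordLeq[OF ordLess_ordLeq_trans[OF small_Pow[OF B1] A]])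
  have x1: "x1 \<in> A"
  proof -
    obtain \<gamma> where \<gamma>: "\<And>l \<zeta>. l \<in> succ_index A \<Longrightarrow> \<zeta> \<in> B1 \<Longrightarrow> (\<gamma> l \<zeta>, x1) \<in> |A|"
      using big1 by (rule bigE) blast
    obtain l where "l \<in> succ_index A" using card_less_nonempty[OF succ_index_greater] by auto
    moreover have "B1 \<noteq> {}" using N1(2) ideal_empty[OF N1(1)] by metis
    then obtain \<zeta> where "\<zeta> \<in> B1" by auto
    ultimately show ?thesis using card_of_in(2)[OF \<gamma>] by simp
  qed
  obtain I where I: "I \<subseteq> L2" "|A| =o |I|"
    by (rule card_less_subset[OF ordLess_imp_ordLeq[OF L2]])
  have bad_I: "|\<Union>i\<in>I. bad i| \<le>o |A|"
    using I L2D(1) bad ordIso_imp_ordLeq[OF ordIso_symmetric[OF I(2)]]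
    by (intro card_of_UNION_ordLeq_infinite[OF infA]) auto
  have "\<not> L2 \<subseteq> (\<Union>i\<in>I. bad i)"
  proof
    assume "L2 \<subseteq> (\<Union>i\<in>I. bad i)"
    then have "|L2| \<le>o |A|" by (rule ordLeq_transitive[OF card_of_mono1 bad_I])
    then show False using L2 not_card_le[of L2 A] by simp
  qed
  \<comment> \<open>There are more than |A| candidates but at most |A| bad indices over
    \<open>I\<close>: \<open>\<psi> s\<close> lies \<open>J\<close>-almost everywhere above each
    \<open>\<psi> i\<close> with \<open>i \<in> I\<close>.\<close>
  then obtain s where s: "s \<in> L2" "\<And>i. i \<in> I \<Longrightarrow> s \<notin> bad i" by auto
  have sL: "s \<in> L1" "s \<in> succ_index A" using L2D(1)[OF s(1)] by (auto simp: L1_def)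
  define D where "D i = {\<epsilon>\<in>C. (\<psi> i \<epsilon>, \<psi> s \<epsilon>) \<in> |A|}" for i
  have D: "D i \<notin> J" if i: "i \<in> I" for i
  proof
    assume "D i \<in> J"
    moreover have "{\<epsilon>\<in>B. (\<psi> s \<epsilon>, \<psi> i \<epsilon>) \<in> |A|} \<in> J" using s(2)[OF i] sL(2) unfolding bad_def by simp
    ultimately have "D i \<union> {\<epsilon>\<in>B. (\<psi> s \<epsilon>, \<psi> i \<epsilon>) \<in> |A|} \<in> J" by (rule ideal_Un[OF J K0(2)])
    moreover have "C \<subseteq> D i \<union> {\<epsilon>\<in>B. (\<psi> s \<epsilon>, \<psi> i \<epsilon>) \<in> |A|}"
    proof
      fix \<epsilon> assume "\<epsilon> \<in> C"
      then have "\<epsilon> \<in> B" using C(1) by auto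
      have "i \<in> L1" using i I(1) L2D(1) by auto
      then have "(\<psi> i \<epsilon>, \<psi> s \<epsilon>) \<in> |A| \<or> (\<psi> s \<epsilon>, \<psi> i \<epsilon>) \<in> |A|"
        using \<psi>A \<open>\<epsilon> \<in> B\<close> sL(1) by (intro card_of_total) auto
      then show "\<epsilon> \<in> D i \<union> {\<epsilon>\<in>B. (\<psi> s \<epsilon>, \<psi> i \<epsilon>) \<in> |A|}"
        using \<open>\<epsilon> \<in> C\<close> \<open>\<epsilon> \<in> B\<close> unfolding D_def by auto
    qed
    ultimately have "C \<in> J" by (rule ideal_subset[OF J])
    then show False using C(2) by simp
  qed
  have PowC: "|Pow C| <o |A|"
    by (rule ordLeq_ordLess_trans[OF card_Pow_mono[OF card_of_mono1[OF C(1)]] ordLess_ordLeq_trans[OF small_Pow[OF B] A]])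
  have D_sub: "D ` I \<subseteq> Pow C" unfolding D_def by auto
  \<comment> \<open>The sets \<open>D i\<close> take fewer than |A| values, so one \<open>C'\<close>
    is shared by enough indices to label all of \<open>under |A| x1\<close>. The labelling
    \<open>e\<close> turns values up to \<open>x1\<close> into functions that do not exceed
    \<open>\<psi> s\<close> on \<open>C'\<close>.\<close>
  obtain C' where C': "|under |A| x1| <o |{i\<in>I. D i = C'}|"
    using large_fiber[OF infA ordIso_symmetric[OF I(2)] D_sub PowC card_under_less[OF infA x1]] by (rule bexE)
  obtain e where e: "inj_on e (under |A| x1)" "e ` under |A| x1 \<subseteq> {i\<in>I. D i = C'}"
    using iffD2[OF card_of_ordLeq ordLess_imp_ordLeq[OF C']] by auto
  obtain i1 where i1: "i1 \<in> I" "D i1 = C'" using card_less_nonempty[OF C'] by auto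
  have C'C: "C' \<subseteq> C" using i1 unfolding D_def by auto
  have C'B: "C' \<subseteq> B" using C'C C(1) by simp
  have C'J: "C' \<notin> J" using D[OF i1(1)] i1(2) by simp
  have eI: "e y \<in> I" "D (e y) = C'" if "y \<in> under |A| x1" for y using e(2) that by auto
  have e_idx: "e y \<in> succ_index A" if "y \<in> under |A| x1" for y
    using eI(1)[OF that] I(1) L2D(1) unfolding L1_def by auto
  have "big A N C' (\<psi> s)"
  proof (rule big_commute[OF infA B1 PowB1 N(1) N1 big1, where \<chi>="\<lambda>y. \<psi> (e y)"])
    show "(\<psi> (e y) \<epsilon>, \<psi> s \<epsilon>) \<in> |A|" if "y \<in> under |A| x1" "\<epsilon> \<in> C'" for y \<epsilon>
      using eI(2)[OF that(1)] that(2) unfolding D_def by auto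
    show "agree (\<psi> (e y)) (\<psi> (e z)) C' \<in> N"
      if y: "y \<in> under |A| x1" and z: "z \<in> under |A| x1" and "y \<noteq> z" for y z
    proof -
      have "e y \<noteq> e z" using inj_onD[OF e(1)] that by metis
      then show ?thesis by (rule ideal_subset[OF N(1) \<psi>_diff[OF e_idx[OF y] e_idx[OF z]] agree_mono[OF C'B]])
    qed
    show "pointwise_cover M (under |A| (\<psi> s \<epsilon>)) K'" if "\<epsilon> \<in> C'" for \<epsilon>
      using that C'C by (intro cov[OF s(1)]) auto
    have "Pow (C' \<times> (C' \<times> K')) \<subseteq> Pow (B \<times> (B \<times> K'))" using C'B by auto
    then show "|Pow (C' \<times> (C' \<times> K'))| \<le>o |K1|" by (rule ordLeq_transitive[OF card_of_mono1 WK1])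
  qed
  then have "C' \<in> J" by (rule into_J[OF sL(1) C'B])
  then show False using C'J by simp
qed

text \<open>Constant functions serve: some \<open>K\<close> is at least as large as
  \<open>A\<close>, and a function into \<open>A\<close> is matched at each point by the constant
  with its value.\<close>

lemma cover_small_case:
  assumes "|A| <o |M|" shows "\<exists>K\<in>\<K>. pointwise_cover M A K"
proof -
  obtain K where K: "K \<in> \<K>" "|A| \<le>o |K|" using cofinal_\<K>[OF assms] by (rule bexE)
  let ?H = "(\<lambda>a (_::'a). a) ` A"
  have "pointwise_cover M A K" unfolding pointwise_cover_def
  proof (intro allI impI, rule exI[of _ ?H], intro conjI allI impI)
    show "|?H| \<le>o |A|" by (rule card_of_image)
    fix \<Theta> :: "'a set" and k assume k: "k ` \<Theta> \<subseteq> A"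
    show "\<exists>C\<subseteq>?H. |C| \<le>o |K| \<and> covers C \<Theta> k"
    proof (intro exI[of _ ?H] conjI)
      show "|?H| \<le>o |K|" by (rule ordLeq_transitive[OF card_of_image K(2)])
      show "covers ?H \<Theta> k" using k unfolding covers_def by auto
    qed simp
  qed
  then show ?thesis using K by auto
qed

text \<open>One \<open>K\<close> is right for cofinally many \<open>b\<close>, since
  counterexamples, one for each \<open>K\<close>, would have a common bound. Every function from
  \<open>\<Theta>\<close> into \<open>A\<close> is bounded by such a \<open>b\<close>, so the union
  of the families for these \<open>b\<close> suffices.\<close>

lemma cover_regular_case:
  assumes A: "|M| \<le>o |A|"
    and IH: "\<And>b. b \<in> A \<Longrightarrow> \<exists>K\<in>\<K>. pointwise_cover M (under |A| b) K"
    and reg: "\<And>X. X \<subseteq> A \<Longrightarrow> |X| <o |M| \<Longrightarrow> \<exists>a\<in>A. \<forall>x\<in>X. (x, a) \<in> |A|"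
  shows "\<exists>K\<in>\<K>. pointwise_cover M A K"
proof -
  have infA: "infinite A" using A infinite_M card_of_ordLeq_finite by blast
  define U where "U K = {b\<in>A. pointwise_cover M (under |A| b) K}" for K
  have "\<exists>K\<in>\<K>. \<forall>a\<in>A. \<exists>b\<in>U K. (a, b) \<in> |A|"
  proof (rule ccontr)
    assume "\<not> ?thesis"
    then have "\<forall>K\<in>\<K>. \<exists>a. a \<in> A \<and> (\<forall>b\<in>U K. (a, b) \<notin> |A| )" by auto
    then obtain a where a: "\<forall>K\<in>\<K>. a K \<in> A \<and> (\<forall>b\<in>U K. (a K, b) \<notin> |A| )" by (rule exE[OF bchoice])
    have "|a ` \<K>| <o |M|" by (rule ordLeq_ordLess_trans[OF card_of_image small_index])
    then obtain c where c: "c \<in> A" "\<forall>x\<in>a ` \<K>. (x, c) \<in> |A|" using reg[of "a ` \<K>"] a by auto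
    obtain K where K: "K \<in> \<K>" "pointwise_cover M (under |A| c) K" using IH[OF c(1)] by auto
    then have "c \<in> U K" using c(1) unfolding U_def by simp
    then show False using a c(2) K(1) by auto
  qed
  then obtain K where K: "K \<in> \<K>" and U: "\<forall>a\<in>A. \<exists>b\<in>U K. (a, b) \<in> |A|" by (rule bexE)
  have "pointwise_cover M A K" unfolding pointwise_cover_def
  proof (intro allI impI)
    fix \<Theta> :: "'a set" assume \<Theta>: "|\<Theta>| <o |M|"
    define Q where "Q b H \<longleftrightarrow> |H| \<le>o |under |A| b| \<and>
      (\<forall>k. k ` \<Theta> \<subseteq> under |A| b \<longrightarrow> (\<exists>D\<subseteq>H. |D| \<le>o |K| \<and> covers D \<Theta> k))"
      for b and H :: "('a \<Rightarrow> 'a) set"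
    have "\<forall>b\<in>U K. \<exists>H. Q b H"
    proof
      fix b assume "b \<in> U K"
      then have "pointwise_cover M (under |A| b) K" unfolding U_def by simp
      then obtain H :: "('a \<Rightarrow> 'a) set" where "|H| \<le>o |under |A| b|"
        "\<forall>k. k ` \<Theta> \<subseteq> under |A| b \<longrightarrow> (\<exists>D\<subseteq>H. |D| \<le>o |K| \<and> covers D \<Theta> k)"
        using \<Theta> by (rule pointwise_coverE)
      then show "\<exists>H. Q b H" unfolding Q_def by (intro exI[of _ H] conjI)
    qed
    then obtain H where H: "\<forall>b\<in>U K. Q b (H b)" by (rule exE[OF bchoice])
    let ?H = "\<Union>b\<in>U K. H b"
    show "\<exists>H::('a \<Rightarrow> 'a) set. |H| \<le>o |A| \<and> (\<forall>k. k ` \<Theta> \<subseteq> A \<longrightarrow>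
        (\<exists>C\<subseteq>H. |C| \<le>o |K| \<and> covers C \<Theta> k))"
    proof (rule exI[of _ ?H], intro conjI allI impI)
      have UA: "|U K| \<le>o |A|" unfolding U_def by (rule card_of_mono1) auto
      have "|H b| \<le>o |A|" if "b \<in> U K" for b
      proof -
        have "b \<in> A" using that unfolding U_def by simp
        have "|H b| \<le>o |under |A| b|" using H that unfolding Q_def by simp
        then show ?thesis
          by (rule ordLeq_transitive[OF _ ordLess_imp_ordLeq[OF card_under_less[OF infA \<open>b \<in> A\<close>]]])
      qed
      then show "|?H| \<le>o |A|" using UA by (intro card_of_UNION_ordLeq_infinite[OF infA]) auto
      fix k :: "'a \<Rightarrow> 'a" assume k: "k ` \<Theta> \<subseteq> A"
      have "|k ` \<Theta>| <o |M|" by (rule ordLeq_ordLess_trans[OF card_of_image \<Theta>])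
      then obtain a where a: "a \<in> A" "\<forall>x\<in>k ` \<Theta>. (x, a) \<in> |A|" using reg[OF k] by auto
      obtain b where b: "b \<in> U K" "(a, b) \<in> |A|" using U a(1) by auto
      have "k ` \<Theta> \<subseteq> under |A| b" using a(2) card_of_trans[OF _ b(2)] unfolding under_def by auto
      moreover have "Q b (H b)" using H b(1) by simp
      ultimately have "\<exists>D\<subseteq>H b. |D| \<le>o |K| \<and> covers D \<Theta> k" unfolding Q_def by (elim conjE allE impE)
      then obtain D where D: "D \<subseteq> H b" "|D| \<le>o |K|" "covers D \<Theta> k" by auto
      moreover have "D \<subseteq> ?H" using D(1) b(1) by auto
      ultimately show "\<exists>C\<subseteq>?H. |C| \<le>o |K| \<and> covers C \<Theta> k" by (intro exI[of _ D] conjI)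
    qed
  qed
  then show ?thesis using K by auto
qed

text \<open>Induction on |A|: as \<open>|A|\<close> is an initial ordinal, each
  \<open>under |A| b\<close> is a smaller instance once \<open>A\<close> is infinite. The cases
  depend on whether |A| < |M| and whether fewer than |M| elements are cofinal.\<close>

theorem revised_GCH:
  fixes A :: "'a set"
  shows "\<exists>K\<in>\<K>. pointwise_cover M A K"
proof (induction "|A|" arbitrary: A rule: wf_induct_rule[OF wf_ordLess])
  case (1 A)
  show ?case
  proof (cases "|A| <o |M|")
    case True
    then show ?thesis by (rule cover_small_case)
  next
    case False
    then have A: "|M| \<le>o |A|" using not_card_le by blast
    then have infA: "infinite A" using infinite_M card_of_ordLeq_finite by blast
    have IH: "\<exists>K\<in>\<K>. pointwise_cover M (under |A| b) K" if "b \<in> A" for b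
      using 1[OF card_under_less[OF infA that]] .
    show ?thesis
    proof (cases "\<exists>X\<subseteq>A. |X| <o |M| \<and> (\<forall>a\<in>A. \<exists>x\<in>X. (a, x) \<in> |A| )")
      case True
      then obtain X where X: "X \<subseteq> A" "|X| <o |M|" "\<forall>a\<in>A. \<exists>x\<in>X. (a, x) \<in> |A|" by auto
      show ?thesis by (rule cover_singular_case[OF A IH X])
    next
      case False
      show ?thesis
      proof (rule cover_regular_case[OF A IH])
        fix X assume X: "X \<subseteq> A" "|X| <o |M|"
        then obtain a where a: "a \<in> A" "\<forall>x\<in>X. (a, x) \<notin> |A|" using False by auto
        then have "\<forall>x\<in>X. (x, a) \<in> |A|" using card_of_total[OF a(1)] X(1) by auto
        then show "\<exists>a\<in>A. \<forall>x\<in>X. (x, a) \<in> |A|" using a(1) by auto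
      qed
    qed
  qed
qed

end

subsection \<open>Ordinals below a regular cardinal\<close>

locale regular_cardinal =
  fixes r :: "'a rel"
  assumes card: "Card_order r" and inf: "infinite (Field r)" and reg: "regularCard r"
begin

lemma well: "Well_order r"
  using card unfolding card_order_on_def by simp

lemma
  shows r_refl: "a \<in> Field r \<Longrightarrow> (a, a) \<in> r"
    and r_trans: "(a, b) \<in> r \<Longrightarrow> (b, c) \<in> r \<Longrightarrow> (a, c) \<in> r"
    and r_antisym: "(a, b) \<in> r \<Longrightarrow> (b, a) \<in> r \<Longrightarrow> a = b"
    and wf_r: "wf (r - Id)"
  using well unfolding well_order_on_def linear_order_on_def partial_order_on_def preorder_on_def
  by (meson refl_onD transD antisymD)+

lemma r_total: "a \<in> Field r \<Longrightarrow> b \<in> Field r \<Longrightarrow> (a, b) \<in> r \<or> (b, a) \<in> r"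
  using well r_refl unfolding well_order_on_def linear_order_on_def total_on_def by metis

lemma r_Field: "(a, b) \<in> r \<Longrightarrow> a \<in> Field r" "(a, b) \<in> r \<Longrightarrow> b \<in> Field r"
  by (auto simp: Field_def)

lemma in_underS: "a \<in> underS r b \<longleftrightarrow> (a, b) \<in> r \<and> a \<noteq> b"
  unfolding underS_def by auto

lemma underS_cases: "a \<in> Field r \<Longrightarrow> b \<in> Field r \<Longrightarrow> a \<in> underS r b \<or> (b, a) \<in> r"
  using r_total r_refl unfolding in_underS by metis

lemma underS_asym: "a \<in> underS r b \<Longrightarrow> (b, a) \<in> r \<Longrightarrow> False"
  unfolding in_underS using r_antisym by blast

lemma underS_less_trans:
  "a \<in> underS r b \<Longrightarrow> (b, c) \<in> r \<Longrightarrow> a \<in> underS r c"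
  "(a, b) \<in> r \<Longrightarrow> b \<in> underS r c \<Longrightarrow> a \<in> underS r c"
  unfolding in_underS using r_trans r_antisym by metis+

lemma card_Field: "|Field r| =o r"
  by (rule card_of_Field_ordIso[OF card])

lemma card_underS: "a \<in> Field r \<Longrightarrow> |underS r a| <o |Field r|"
  by (rule ordLess_ordIso_trans[OF card_of_underS[OF card] ordIso_symmetric[OF card_Field]])

lemma ex_greater: "a \<in> Field r \<Longrightarrow> \<exists>b\<in>Field r. a \<in> underS r b"
  using infinite_Card_order_limit[OF card inf] unfolding in_underS by metis

lemma small_bounded:
  assumes X: "X \<subseteq> Field r" "|X| <o |Field r|"
  shows "\<exists>a\<in>Field r. \<forall>x\<in>X. x \<in> underS r a"
proof -
  have "\<not> cofinal X r"
  proof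
    assume "cofinal X r"
    then have "|X| =o r" using reg X(1) unfolding regularCard_def by simp
    then have "|X| =o |Field r|" by (rule ordIso_transitive[OF _ ordIso_symmetric[OF card_Field]])
    then show False using X(2) not_ordLess_ordIso by blast
  qed
  then obtain a where a: "a \<in> Field r" "\<forall>b\<in>X. \<not> (a \<noteq> b \<and> (a, b) \<in> r)"
    unfolding cofinal_def by auto
  obtain b where b: "b \<in> Field r" "a \<in> underS r b" using ex_greater[OF a(1)] by (rule bexE)
  have "x \<in> underS r b" if "x \<in> X" for x
  proof -
    have "x \<in> Field r" using that X(1) by auto
    then have "(x, a) \<in> r" using a that r_total[of x a] r_refl[of a] by (cases "x = a") auto
    then show ?thesis using b(2) by (rule underS_less_trans(2))
  qed
  then show ?thesis using b(1) by auto
qed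

section \<open>Suprema and unbounded sets\<close>

lemma ex_sup:
  assumes a: "a \<in> Field r" "\<forall>x\<in>X. (x, a) \<in> r" shows "\<exists>\<delta>. is_sup r X \<delta>"
proof (rule wfE_min[OF wf_r, of a "{b\<in>Field r. \<forall>x\<in>X. (x, b) \<in> r}"])
  show "a \<in> {b\<in>Field r. \<forall>x\<in>X. (x, b) \<in> r}" using a by simp
  fix \<delta> assume d: "\<delta> \<in> {b\<in>Field r. \<forall>x\<in>X. (x, b) \<in> r}"
    and min: "\<And>b. (b, \<delta>) \<in> r - Id \<Longrightarrow> b \<notin> {b\<in>Field r. \<forall>x\<in>X. (x, b) \<in> r}"
  have "(\<delta>, b) \<in> r" if "b \<in> Field r" "\<forall>x\<in>X. (x, b) \<in> r" for b
    using min[of b] that d underS_cases[of b \<delta>] unfolding in_underS by auto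
  then show "\<exists>\<delta>. is_sup r X \<delta>" using d unfolding is_sup_def by auto
qed

lemma is_supD:
  assumes "is_sup r X \<delta>"
  shows "\<delta> \<in> Field r" "x \<in> X \<Longrightarrow> (x, \<delta>) \<in> r"
    "b \<in> Field r \<Longrightarrow> (\<And>x. x \<in> X \<Longrightarrow> (x, b) \<in> r) \<Longrightarrow> (\<delta>, b) \<in> r"
  using assms unfolding is_sup_def by auto

lemma is_sup_ex_above:
  assumes "is_sup r X \<delta>" "X \<subseteq> Field r" "b \<in> underS r \<delta>" shows "\<exists>x\<in>X. b \<in> underS r x"
proof (rule ccontr)
  assume neg: "\<not> ?thesis"
  have b: "b \<in> Field r" using assms(3) r_Field unfolding in_underS by blast
  have "(x, b) \<in> r" if "x \<in> X" for x using neg that underS_cases[of b x] assms(2) b by auto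
  then have "(\<delta>, b) \<in> r" by (rule is_supD(3)[OF assms(1) b])
  then show False using assms(3) underS_asym by blast
qed

lemma unbounded_if_card:
  assumes "A \<subseteq> Field r" "|A| =o |Field r|" shows "unbounded r A"
  unfolding unbounded_def
proof (intro conjI ballI)
  fix x assume x: "x \<in> Field r"
  show "\<exists>c\<in>A. (x, c) \<in> r"
  proof (rule ccontr)
    assume "\<not> ?thesis"
    then have "A \<subseteq> underS r x" using assms(1) x underS_cases[of _ x] by blast
    then have "|A| <o |Field r|" by (rule ordLeq_ordLess_trans[OF card_of_mono1 card_underS[OF x]])
    then show False using assms(2) not_ordLess_ordIso by blast
  qed
qed (rule assms(1))

section \<open>Initial segments and the cardinals below lambda\<close>

lemma Field_Restr: "A \<subseteq> Field r \<Longrightarrow> Field (Restr r A) = A"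
  using r_refl by (fastforce simp: Field_def)

lemma underS_sub: "underS r a \<subseteq> Field r"
  using r_Field unfolding in_underS[symmetric] underS_def by auto

lemma underS_Restr_eq: "b \<in> underS r a \<Longrightarrow> underS (Restr r (underS r a)) b = underS r b"
  using underS_less_trans(1)[of _ b a] unfolding in_underS underS_def by blast

lemma is_cardinalD:
  assumes "is_cardinal r \<mu>"
  shows "\<mu> \<in> Field r" "Card_order (Restr r (underS r \<mu>))"
    "|underS r \<mu>| =o Restr r (underS r \<mu>)"
proof -
  show 1: "\<mu> \<in> Field r" "Card_order (Restr r (underS r \<mu>))"
    using assms unfolding is_cardinal_def by auto
  show "|underS r \<mu>| =o Restr r (underS r \<mu>)"
    using card_of_Field_ordIso[OF 1(2)] Field_Restr[OF underS_sub] by simp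
qed

lemma card_underS_cardinal:
  assumes \<mu>: "is_cardinal r \<mu>" and b: "b \<in> underS r \<mu>"
  shows "|underS r b| <o |underS r \<mu>|"
proof -
  have "|underS (Restr r (underS r \<mu>)) b| <o Restr r (underS r \<mu>)"
    using b by (intro card_of_underS[OF is_cardinalD(2)[OF \<mu>]]) (simp add: Field_Restr[OF underS_sub])
  then show ?thesis
    unfolding underS_Restr_eq[OF b] by (rule ordLess_ordIso_trans[OF _ ordIso_symmetric[OF is_cardinalD(3)[OF \<mu>]]])
qed

lemma underS_mono: "(a, b) \<in> r \<Longrightarrow> underS r a \<subseteq> underS r b"
  using underS_less_trans(1) by blast

lemma ex_cardinal:
  assumes "|Y| <o |Field r|" shows "\<exists>\<nu>\<in>Field r. is_cardinal r \<nu> \<and> |underS r \<nu>| =o |Y|"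
proof -
  have "|Y| <o r" by (rule ordLess_ordIso_trans[OF assms card_Field])
  then obtain \<nu> where \<nu>: "\<nu> \<in> Field r" and Y: "|Y| =o Restr r (underS r \<nu>)"
    using ordLess_iff_ordIso_Restr[OF well card_of_Well_order] by auto
  have "Card_order (Restr r (underS r \<nu>))"
    by (rule Card_order_ordIso[OF card_of_Card_order ordIso_symmetric[OF Y]])
  then have c: "is_cardinal r \<nu>" using \<nu> unfolding is_cardinal_def by simp
  show ?thesis
    using ordIso_transitive[OF is_cardinalD(3)[OF c] ordIso_symmetric[OF Y]] \<nu> c by auto
qed

lemma ex_cardinal_below:
  assumes \<mu>: "\<mu> \<in> Field r" and Y: "|Y| <o |underS r \<mu>|"
  shows "\<exists>\<nu>\<in>underS r \<mu>. is_cardinal r \<nu> \<and> |underS r \<nu>| =o |Y|"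
proof -
  obtain \<nu> where \<nu>: "\<nu> \<in> Field r" "is_cardinal r \<nu>" "|underS r \<nu>| =o |Y|"
    using ex_cardinal[OF ordLess_transitive[OF Y card_underS[OF \<mu>]]] by auto
  have "\<nu> \<in> underS r \<mu>"
  proof (rule ccontr)
    assume "\<nu> \<notin> underS r \<mu>"
    then have "(\<mu>, \<nu>) \<in> r" using underS_cases[OF \<nu>(1) \<mu>] by simp
    then have "|underS r \<mu>| \<le>o |underS r \<nu>|" by (intro card_of_mono1 underS_mono)
    then have "|underS r \<mu>| \<le>o |Y|" by (rule ordLeq_ordIso_trans[OF _ \<nu>(3)])
    then show False using Y not_card_le by blast
  qed
  then show ?thesis using \<nu> by auto
qed

text \<open>Makes \<open>small_bounded\<close> available inside \<open>\<kappa>\<close>.\<close>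

lemma regular_below:
  assumes "is_regular r \<kappa>" shows "regular_cardinal (Restr r (underS r \<kappa>))"
  using assms Field_Restr[OF underS_sub] unfolding is_regular_def is_cardinal_def
  by (intro regular_cardinal.intro) simp_all

lemma regular_bounded:
  assumes \<kappa>: "is_regular r \<kappa>" and X: "X \<subseteq> underS r \<kappa>" "|X| <o |underS r \<kappa>|"
  shows "\<exists>a\<in>underS r \<kappa>. \<forall>x\<in>X. x \<in> underS r a"
proof -
  obtain a where a: "a \<in> underS r \<kappa>" "\<forall>x\<in>X. x \<in> underS (Restr r (underS r \<kappa>)) a"
    using regular_cardinal.small_bounded[OF regular_below[OF \<kappa>], of X] X
    unfolding Field_Restr[OF underS_sub] by auto
  then show ?thesis unfolding underS_Restr_eq[OF a(1)] by auto
qed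

text \<open>A strictly increasing sequence of length \<open>\<kappa>\<close> is built in
  \<open>C\<close> above \<open>y\<close>, with members of \<open>A\<close> interleaved. Its
  supremum is a limit of both \<open>C\<close> and \<open>A\<close>, and has cofinality
  \<open>\<kappa>\<close> by regularity of \<open>\<kappa>\<close>.\<close>

lemma ex_limit_point:
  assumes \<kappa>: "is_regular r \<kappa>" and C: "club r C" and A: "unbounded r A" and y: "y \<in> Field r"
  shows "\<exists>\<delta>\<in>C \<inter> S_cof r \<kappa>. (y, \<delta>) \<in> r \<and> is_sup r (A \<inter> underS r \<delta>) \<delta>"
proof -
  let ?K = "underS r \<kappa>"
  have \<kappa>c: "is_cardinal r \<kappa>" and infK: "infinite ?K" using \<kappa> unfolding is_regular_def by auto
  note \<kappa>F = is_cardinalD(1)[OF \<kappa>c]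
  have AF: "A \<subseteq> Field r" and CF: "C \<subseteq> Field r" using A C unfolding club_def unbounded_def by auto
  \<comment> \<open>The recursion runs along all of \<open>r\<close>, so the condition is void
    outside \<open>\<kappa>\<close>. The element \<open>a\<close>, above all earlier values and
    below the new one, makes the sequence increase strictly and \<open>A\<close> cofinal in its
    supremum.\<close>
  define P where "P f i z \<longleftrightarrow> (i \<in> ?K \<longrightarrow> z \<in> C \<and> (y, z) \<in> r \<and>
    (\<exists>a\<in>A. a \<in> underS r z \<and> (\<forall>j\<in>underS r i. f j \<in> underS r a)))" for f i z
  have "\<exists>x. \<forall>i. P x i (x i)"
  proof (rule dependent_wf_choice[OF wf_r])
    fix f g :: "'a \<Rightarrow> 'a" and i z assume eq: "\<And>j. (j, i) \<in> r - Id \<Longrightarrow> f j = g j"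
    have "(\<forall>j\<in>underS r i. f j \<in> underS r a) \<longleftrightarrow> (\<forall>j\<in>underS r i. g j \<in> underS r a)" for a
      using eq by (intro ball_cong) (auto simp: in_underS)
    then show "P f i z = P g i z" unfolding P_def by simp
  next
    fix i f assume IH: "\<And>j. (j, i) \<in> r - Id \<Longrightarrow> P f j (f j)"
    show "\<exists>z. P f i z"
    proof (cases "i \<in> ?K")
      case True
      have "i \<in> Field r" using True underS_sub by auto
      have "f j \<in> Field r" if "j \<in> underS r i" for j
      proof -
        have "j \<in> ?K" using that True underS_less_trans(2) unfolding in_underS by blast
        moreover have "P f j (f j)" using that by (intro IH) (auto simp: in_underS)
        ultimately show ?thesis using CF unfolding P_def by auto
      qed
      moreover have "|f ` underS r i| <o |Field r|"
        by (rule ordLeq_ordLess_trans[OF card_of_image card_underS[OF \<open>i \<in> Field r\<close>]])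
      ultimately obtain b where b: "b \<in> Field r" "\<forall>w\<in>f ` underS r i. w \<in> underS r b"
        using small_bounded[of "f ` underS r i"] by auto
      obtain a where a: "a \<in> A" "(b, a) \<in> r" using A b(1) unfolding unbounded_def by auto
      have "|{a, y}| <o |Field r|" using inf by (intro card_finite_less) auto
      then obtain c where c: "c \<in> Field r" "a \<in> underS r c" "y \<in> underS r c"
        using small_bounded[of "{a, y}"] a(1) AF y by auto
      obtain z where z: "z \<in> C" "(c, z) \<in> r" using C c(1) unfolding club_def unbounded_def by auto
      have "a \<in> underS r z" "(y, z) \<in> r"
        using underS_less_trans(1)[OF c(2) z(2)] underS_less_trans(1)[OF c(3) z(2)] by (auto simp: in_underS)
      moreover have "\<forall>j\<in>underS r i. f j \<in> underS r a" using b(2) underS_less_trans(1)[OF _ a(2)] by auto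
      ultimately show ?thesis using z(1) a(1) unfolding P_def by auto
    qed (simp add: P_def)
  qed
  then obtain x where x: "\<And>i. P x i (x i)" by auto
  have xC: "x i \<in> C" "(y, x i) \<in> r" if "i \<in> ?K" for i using x[of i] that unfolding P_def by auto
  have xA: "\<exists>a\<in>A. a \<in> underS r (x i) \<and> x j \<in> underS r a" if "i \<in> ?K" "j \<in> underS r i" for i j
    using x[of i] that unfolding P_def by auto
  have x_mono: "x j \<in> underS r (x i)" if ij: "i \<in> ?K" "j \<in> underS r i" for i j
  proof -
    obtain a where "a \<in> underS r (x i)" "x j \<in> underS r a" using xA[OF ij] by auto
    then show ?thesis using underS_less_trans(1)[of "x j" a "x i"] by (auto simp: in_underS)
  qed
  have K_lim: "\<exists>i\<in>?K. j \<in> underS r i" if "j \<in> ?K" for j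
    using regular_bounded[OF \<kappa>, of "{j}"] that card_finite_less[OF _ infK, of "{j}"] by auto
  have xF: "x ` ?K \<subseteq> Field r" using xC(1) CF by auto
  have "|x ` ?K| <o |Field r|" by (rule ordLeq_ordLess_trans[OF card_of_image card_underS[OF \<kappa>F]])
  then obtain b where "b \<in> Field r" "\<forall>w\<in>x ` ?K. w \<in> underS r b" using small_bounded[OF xF] by auto
  then obtain \<delta> where \<delta>: "is_sup r (x ` ?K) \<delta>" using ex_sup[of b "x ` ?K"] by (auto simp: in_underS)
  note \<delta>F = is_supD(1)[OF \<delta>]
  have x\<delta>: "x i \<in> underS r \<delta>" if i: "i \<in> ?K" for i
  proof -
    obtain k where "k \<in> ?K" "i \<in> underS r k" using K_lim[OF i] by auto
    then show ?thesis using underS_less_trans(1)[OF x_mono is_supD(2)[OF \<delta>]] by auto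
  qed
  obtain i0 where i0: "i0 \<in> ?K" using infK by fastforce
  have "is_sup r (C \<inter> underS r \<delta>) \<delta>"
    unfolding is_sup_def
  proof (intro conjI ballI impI)
    fix b assume b: "b \<in> Field r" "\<forall>w\<in>C \<inter> underS r \<delta>. (w, b) \<in> r"
    show "(\<delta>, b) \<in> r" using b(2) xC(1) x\<delta> by (intro is_supD(3)[OF \<delta> b(1)]) auto
  qed (auto simp: \<delta>F in_underS)
  then have \<delta>C: "\<delta> \<in> C" using C \<delta>F xC(1)[OF i0] x\<delta>[OF i0] unfolding club_def by auto
  have "is_sup r (A \<inter> underS r \<delta>) \<delta>"
    unfolding is_sup_def
  proof (intro conjI ballI impI)
    fix b assume b: "b \<in> Field r" "\<forall>w\<in>A \<inter> underS r \<delta>. (w, b) \<in> r"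
    show "(\<delta>, b) \<in> r"
    proof (rule is_supD(3)[OF \<delta> b(1)])
      fix w assume "w \<in> x ` ?K"
      then obtain j where j: "j \<in> ?K" "w = x j" by auto
      obtain i where i: "i \<in> ?K" "j \<in> underS r i" using K_lim[OF j(1)] by auto
      obtain a where a: "a \<in> A" "a \<in> underS r (x i)" "x j \<in> underS r a" using xA[OF i] by auto
      have "a \<in> underS r \<delta>" using underS_less_trans(1)[OF a(2)] x\<delta>[OF i(1)] by (auto simp: in_underS)
      then have "(a, b) \<in> r" using b(2) a(1) by auto
      then show "(w, b) \<in> r" using r_trans a(3) j(2) by (auto simp: in_underS)
    qed
  qed (auto simp: \<delta>F in_underS)
  moreover have "cof_eq r \<delta> \<kappa>"
    unfolding cof_eq_def ord_card_def
  proof (intro conjI allI impI)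
    have "inj_on x ?K"
    proof (rule inj_onI, rule ccontr)
      fix i j assume ij: "i \<in> ?K" "j \<in> ?K" "x i = x j" "i \<noteq> j"
      then have "i \<in> underS r j \<or> j \<in> underS r i"
        using r_total[OF subsetD[OF underS_sub] subsetD[OF underS_sub], of i \<kappa> j \<kappa>]
        by (auto simp: in_underS)
      then show False using x_mono[of j i] x_mono[of i j] ij by (auto simp: in_underS)
    qed
    then have "|x ` ?K| =o |?K|" by (intro ordIso_symmetric[OF card_of_ordIsoI]) (rule inj_on_imp_bij_betw)
    moreover have "x ` ?K \<subseteq> underS r \<delta>" using x\<delta> by auto
    ultimately show "\<exists>X\<subseteq>underS r \<delta>. is_sup r X \<delta> \<and> |X| =o |?K|" using \<delta> by auto
    fix X assume X: "X \<subseteq> underS r \<delta> \<and> is_sup r X \<delta>"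
    show "|?K| \<le>o |X|"
    proof (rule ccontr)
      assume "\<not> ?thesis"
      then have XK: "|X| <o |?K|" by (simp only: not_card_le)
      \<comment> \<open>A smaller cofinal set would be dominated by fewer than
        \<open>\<kappa>\<close> terms of the sequence, hence by a single term \<open>x k\<close>,
        which is below \<open>\<delta>\<close>.\<close>
      have "\<forall>w\<in>X. \<exists>i. i \<in> ?K \<and> w \<in> underS r (x i)"
        using is_sup_ex_above[OF \<delta> xF] X by auto
      then obtain j where j: "\<forall>w\<in>X. j w \<in> ?K \<and> w \<in> underS r (x (j w))" by (rule exE[OF bchoice])
      have "|j ` X| <o |?K|" by (rule ordLeq_ordLess_trans[OF card_of_image XK])
      then obtain k where k: "k \<in> ?K" "\<forall>i\<in>j ` X. i \<in> underS r k"
        using regular_bounded[OF \<kappa>, of "j ` X"] j by auto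
      have "(\<delta>, x k) \<in> r"
      proof (rule is_supD(3))
        show "is_sup r X \<delta>" using X by simp
        show "x k \<in> Field r" using xF k(1) by auto
        fix w assume "w \<in> X"
        then have "w \<in> underS r (x (j w))" "x (j w) \<in> underS r (x k)"
          using j k x_mono by auto
        then show "(w, x k) \<in> r" using r_trans by (auto simp: in_underS)
      qed
      then show False using x\<delta>[OF k(1)] underS_asym by blast
    qed
  qed (use \<delta>F \<kappa>c in auto)
  moreover have "(y, \<delta>) \<in> r" using r_trans[OF xC(2)[OF i0]] x\<delta>[OF i0] by (auto simp: in_underS)
  ultimately show ?thesis using \<delta>C \<delta>F unfolding S_cof_def by auto
qed

lemma club_Field: "club r (Field r)"
  unfolding club_def unbounded_def using r_refl by auto

text \<open>Unboundedness comes from \<open>ex_limit_point\<close> with the club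
  \<open>Field r\<close>; closure holds because limits of limit points of \<open>A\<close> are limit
  points of \<open>A\<close>.\<close>

lemma club_limit_points:
  assumes \<kappa>: "is_regular r \<kappa>" and A: "unbounded r A"
  shows "club r {\<delta>\<in>Field r. is_sup r (A \<inter> underS r \<delta>) \<delta>}" (is "club r ?E")
  unfolding club_def
proof (intro conjI ballI impI)
  show "unbounded r ?E" unfolding unbounded_def
  proof (intro conjI ballI)
    fix y assume "y \<in> Field r"
    from ex_limit_point[OF \<kappa> club_Field A this]
    show "\<exists>c\<in>?E. (y, c) \<in> r" by (auto simp: S_cof_def)
  qed auto
  fix \<delta> assume \<delta>: "\<delta> \<in> Field r" "?E \<inter> underS r \<delta> \<noteq> {} \<and> is_sup r (?E \<inter> underS r \<delta>) \<delta>"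
  have "is_sup r (A \<inter> underS r \<delta>) \<delta>"
    unfolding is_sup_def
  proof (intro conjI ballI impI)
    fix b assume b: "b \<in> Field r" "\<forall>w\<in>A \<inter> underS r \<delta>. (w, b) \<in> r"
    show "(\<delta>, b) \<in> r"
    proof (rule is_supD(3)[of "?E \<inter> underS r \<delta>"])
      fix e assume e: "e \<in> ?E \<inter> underS r \<delta>"
      then have sup: "is_sup r (A \<inter> underS r e) e" and sub: "underS r e \<subseteq> underS r \<delta>"
        using underS_mono[of e \<delta>] by (auto simp: in_underS)
      show "(e, b) \<in> r" by (rule is_supD(3)[OF sup b(1)]) (use b(2) sub in auto)
    qed (use \<delta> b in auto)
  qed (auto simp: \<delta>(1) in_underS)
  then show "\<delta> \<in> ?E" using \<delta>(1) by simp
qed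

text \<open>A cofinal subset of \<open>A \<inter> underS r \<delta>\<close> of size at most
  \<open>\<kappa>\<close> is a union of at most |K| members of \<open>P\<close>. If each were
  bounded below \<open>\<delta>\<close>, the bounds would form a cofinal set of size at most |K|,
  which is below the cofinality \<open>\<kappa>\<close>.\<close>

lemma sup_in_family:
  assumes cof: "cof_eq r \<delta> \<kappa>" and lim: "is_sup r (A \<inter> underS r \<delta>) \<delta>" and K: "|K| <o |underS r \<kappa>|"
    and dec: "\<And>a. a \<subseteq> underS r \<delta> \<Longrightarrow> |a| \<le>o |underS r \<kappa>| \<Longrightarrow> \<exists>C\<subseteq>P. |C| \<le>o |K| \<and> a = \<Union>C"
    and P: "\<And>X. X \<in> P \<Longrightarrow> X \<subseteq> underS r \<delta>"
  shows "\<exists>X\<in>P. X \<subseteq> A \<and> is_sup r X \<delta>"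
proof (rule ccontr)
  assume neg: "\<not> ?thesis"
  have \<delta>F: "\<delta> \<in> Field r" using cof unfolding cof_eq_def by simp
  obtain X where X: "X \<subseteq> underS r \<delta>" "is_sup r X \<delta>" "|X| =o |underS r \<kappa>|"
    using cof unfolding cof_eq_def ord_card_def by auto
  have "\<forall>x\<in>X. \<exists>a. a \<in> A \<inter> underS r \<delta> \<and> x \<in> underS r a"
  proof
    fix x assume "x \<in> X"
    then show "\<exists>a. a \<in> A \<inter> underS r \<delta> \<and> x \<in> underS r a"
      using is_sup_ex_above[OF lim, of x] underS_sub[of \<delta>] X(1) by auto
  qed
  then obtain g where g: "\<forall>x\<in>X. g x \<in> A \<inter> underS r \<delta> \<and> x \<in> underS r (g x)" by (rule exE[OF bchoice])
  have "|g ` X| \<le>o |underS r \<kappa>|" by (rule ordLeq_ordIso_trans[OF card_of_image X(3)])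
  moreover have "g ` X \<subseteq> underS r \<delta>" using g by auto
  ultimately have "\<exists>C\<subseteq>P. |C| \<le>o |K| \<and> g ` X = \<Union>C" by (intro dec)
  then obtain C where C: "C \<subseteq> P" "|C| \<le>o |K|" "g ` X = \<Union>C" by auto
  have "\<forall>c\<in>C. \<exists>b. b \<in> underS r \<delta> \<and> (\<forall>w\<in>c. (w, b) \<in> r)"
  proof
    fix c assume c: "c \<in> C"
    then have "c \<subseteq> g ` X" using C(3) by auto
    then have "c \<subseteq> A" using g by auto
    then have "\<not> is_sup r c \<delta>" using neg c C(1) by auto
    moreover have "\<forall>w\<in>c. (w, \<delta>) \<in> r" using P[OF subsetD[OF C(1) c]] by (auto simp: in_underS)
    ultimately obtain b where b: "b \<in> Field r" "\<forall>w\<in>c. (w, b) \<in> r" "(\<delta>, b) \<notin> r"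
      using \<delta>F unfolding is_sup_def by auto
    then show "\<exists>b. b \<in> underS r \<delta> \<and> (\<forall>w\<in>c. (w, b) \<in> r)" using underS_cases[OF b(1) \<delta>F] by auto
  qed
  then obtain b where b: "\<forall>c\<in>C. b c \<in> underS r \<delta> \<and> (\<forall>w\<in>c. (w, b c) \<in> r)" by (rule exE[OF bchoice])
  have "is_sup r (b ` C) \<delta>" unfolding is_sup_def
  proof (intro conjI ballI impI)
    show "(w, \<delta>) \<in> r" if "w \<in> b ` C" for w using that b by (auto simp: in_underS)
    fix d assume d: "d \<in> Field r" "\<forall>w\<in>b ` C. (w, d) \<in> r"
    show "(\<delta>, d) \<in> r"
    proof (rule is_supD(3)[OF X(2) d(1)])
      fix x assume x: "x \<in> X"
      then have "g x \<in> \<Union>C" using C(3) by auto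
      then obtain c where c: "c \<in> C" "g x \<in> c" by auto
      then have "(g x, b c) \<in> r" "(b c, d) \<in> r" using b d(2) by auto
      moreover have "(x, g x) \<in> r" using g x by (auto simp: in_underS)
      ultimately show "(x, d) \<in> r" using r_trans by blast
    qed
  qed (rule \<delta>F)
  moreover have "b ` C \<subseteq> underS r \<delta>" using b by auto
  ultimately have "|underS r \<kappa>| \<le>o |b ` C|" using cof unfolding cof_eq_def ord_card_def by auto
  then have "|underS r \<kappa>| \<le>o |K|" by (rule ordLeq_transitive[OF _ ordLeq_transitive[OF card_of_image C(2)]])
  then show False using K not_card_le by blast
qed

text \<open>A nonempty \<open>a\<close> is the range of some \<open>k\<close> on
  \<open>\<kappa>\<close>, and each covering function contributes the image of the set where it
  agrees with \<open>k\<close>. Such pieces are images of subsets of \<open>\<kappa>\<close> under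
  members of \<open>H\<close>, so there are fewer than lambda. The ordinal \<open>\<beta>\<close>
  may exceed \<open>\<delta>\<close> because a uniform \<open>K\<close> is known only for
  unboundedly many \<open>\<beta>\<close>.\<close>

lemma ex_union_family:
  assumes cov: "pointwise_cover M (underS r \<beta>) K" and \<delta>\<beta>: "(\<delta>, \<beta>) \<in> r"
    and \<kappa>M: "|underS r \<kappa>| <o |M|" and pow: "|Pow (underS r \<kappa>)| <o |Field r|"
  shows "\<exists>P. small_family r \<kappa> \<delta> P \<and>
    (\<forall>a. a \<subseteq> underS r \<delta> \<longrightarrow> |a| \<le>o |underS r \<kappa>| \<longrightarrow> (\<exists>C\<subseteq>P. |C| \<le>o |K| \<and> a = \<Union>C))"
proof -
  let ?K = "underS r \<kappa>"
  obtain H :: "('a \<Rightarrow> 'a) set" where H: "|H| \<le>o |underS r \<beta>|"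
    "\<forall>k. k ` ?K \<subseteq> underS r \<beta> \<longrightarrow> (\<exists>D\<subseteq>H. |D| \<le>o |K| \<and> covers D ?K k)"
    using cov \<kappa>M by (rule pointwise_coverE)
  define P where "P = {X\<in>(\<lambda>(h, B). h ` B) ` (H \<times> Pow ?K). X \<subseteq> underS r \<delta>}"
  have "|H| <o |Field r|" by (rule ordLeq_ordLess_trans[OF H(1) card_underS[OF r_Field(2)[OF \<delta>\<beta>]]])
  then have "|H \<times> Pow ?K| <o |Field r|" by (rule card_Times_less[OF inf _ pow])
  then have "|(\<lambda>(h, B). h ` B) ` (H \<times> Pow ?K)| <o |Field r|" by (rule ordLeq_ordLess_trans[OF card_of_image])
  then have "|P| <o |Field r|" unfolding P_def by (rule ordLeq_ordLess_trans[OF card_of_mono1, rotated]) auto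
  moreover have "small_subset r \<kappa> \<delta> X" if XP: "X \<in> P" for X
  proof -
    obtain h B where hB: "X = h ` B" "B \<subseteq> ?K" "X \<subseteq> underS r \<delta>" using XP unfolding P_def by auto
    have "|X| \<le>o |?K|" unfolding hB(1) by (rule ordLeq_transitive[OF card_of_image card_of_mono1[OF hB(2)]])
    then show ?thesis using hB(3) unfolding small_subset_def ord_card_def by simp
  qed
  ultimately have "small_family r \<kappa> \<delta> P" unfolding small_family_def by simp
  moreover have "\<exists>C\<subseteq>P. |C| \<le>o |K| \<and> a = \<Union>C" if a: "a \<subseteq> underS r \<delta>" "|a| \<le>o |?K|" for a
  proof (cases "a = {}")
    case True
    then show ?thesis by (intro exI[of _ "{}"]) (simp add: card_of_empty)
  next
    case False
    then obtain k where k: "k ` ?K = a" using iffD2[OF card_of_ordLeq2 a(2)] by auto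
    then have "k ` ?K \<subseteq> underS r \<beta>" using a(1) underS_mono[OF \<delta>\<beta>] by simp
    then have "\<exists>D\<subseteq>H. |D| \<le>o |K| \<and> covers D ?K k" using H(2) by simp
    then obtain D where D: "D \<subseteq> H" "|D| \<le>o |K|" "covers D ?K k" by auto
    define C where "C = (\<lambda>h. h ` agree h k ?K) ` D"
    have "|C| \<le>o |K|" unfolding C_def by (rule ordLeq_transitive[OF card_of_image D(2)])
    moreover have sub: "h ` agree h k ?K \<subseteq> a" for h using k unfolding agree_def by auto
    moreover have "C \<subseteq> P"
    proof
      fix X assume "X \<in> C"
      then obtain h where h: "h \<in> D" "X = h ` agree h k ?K" unfolding C_def by auto
      have "X \<in> (\<lambda>(h, B). h ` B) ` (H \<times> Pow ?K)"
        using h D(1) by (intro image_eqI[of _ _ "(h, agree h k ?K)"]) (auto simp: agree_def)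
      then show "X \<in> P" using sub[of h] a(1) h(2) unfolding P_def by auto
    qed
    moreover have "a \<subseteq> \<Union>C"
    proof
      fix w assume "w \<in> a"
      then obtain \<zeta> where \<zeta>: "\<zeta> \<in> ?K" "w = k \<zeta>" using k by auto
      have "\<exists>h\<in>D. h \<zeta> = k \<zeta>" using D(3) \<zeta>(1) unfolding covers_def by (rule bspec)
      then obtain h where "h \<in> D" "h \<zeta> = k \<zeta>" by (rule bexE)
      then show "w \<in> \<Union>C" using \<zeta> unfolding C_def agree_def by (auto intro!: bexI[of _ h] image_eqI[of _ _ \<zeta>])
    qed
    ultimately show ?thesis unfolding C_def by (intro exI[of _ C]) (auto simp: C_def)
  qed
  ultimately show ?thesis by auto
qed

text \<open>A nonempty union of at most |K| members is coded by a function from \<open>\<nu>\<close>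
  to \<open>\<theta>\<close>, cardinals of the sizes of \<open>K\<close> and \<open>P\<close>. As
  \<open>\<nu>\<close> is below \<open>\<kappa>\<close>, the arithmetic hypothesis bounds the number
  of codes.\<close>

lemma card_unions:
  fixes P :: "'b set set"
  assumes \<kappa>: "is_cardinal r \<kappa>" and K: "|K| <o |underS r \<kappa>|" and P: "|P| <o |Field r|"
    and pow: "\<forall>\<theta>. is_cardinal r \<theta> \<longrightarrow> pow_below_lt_top r \<theta> \<kappa>"
  shows "|{\<Union>C | C. C \<subseteq> P \<and> |C| \<le>o |K|}| <o |Field r|"
proof -
  obtain \<theta> where \<theta>: "is_cardinal r \<theta>" "|underS r \<theta>| =o |P|" using ex_cardinal[OF P] by auto
  obtain \<nu> where \<nu>: "\<nu> \<in> underS r \<kappa>" "is_cardinal r \<nu>" "|underS r \<nu>| =o |K|"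
    using ex_cardinal_below[OF is_cardinalD(1)[OF \<kappa>] K] by auto
  have "olt r \<nu> \<kappa>" using \<nu>(1) unfolding olt_def in_underS by simp
  moreover obtain \<beta> where \<beta>: "\<beta> \<in> Field r" "\<forall>\<nu>. is_cardinal r \<nu> \<and> olt r \<nu> \<kappa> \<longrightarrow>
        |Func (underS r \<nu>) (underS r \<theta>)| \<le>o |underS r \<beta>|"
    using pow \<theta>(1) unfolding pow_below_lt_top_def ord_card_def by auto
  ultimately have "|Func (underS r \<nu>) (underS r \<theta>)| \<le>o |underS r \<beta>|" using \<nu>(2) by simp
  then have F: "|Func (underS r \<nu>) (underS r \<theta>)| <o |Field r|"
    by (rule ordLeq_ordLess_trans[OF _ card_underS[OF \<beta>(1)]])
  obtain t where t: "bij_betw t (underS r \<theta>) P" using iffD2[OF card_of_ordIso \<theta>(2)] by auto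
  let ?F = "(\<lambda>q. \<Union>(t ` q ` underS r \<nu>)) ` Func (underS r \<nu>) (underS r \<theta>)"
  have "|?F| <o |Field r|" by (rule ordLeq_ordLess_trans[OF card_of_image F])
  \<comment> \<open>The empty union is counted separately, since enumerating \<open>C\<close> by
    \<open>\<nu>\<close> needs \<open>C\<close> nonempty.\<close>
  moreover have "|{{}}::'b set set| <o |Field r|" using inf by (intro card_finite_less) simp_all
  ultimately have "|{{}} \<union> ?F| <o |Field r|" by (rule card_of_Un_ordLess_infinite[OF inf, rotated])
  moreover have "{\<Union>C | C. C \<subseteq> P \<and> |C| \<le>o |K|} \<subseteq> {{}} \<union> ?F"
  proof
    fix a assume "a \<in> {\<Union>C | C. C \<subseteq> P \<and> |C| \<le>o |K|}"
    then obtain C where C: "a = \<Union>C" "C \<subseteq> P" "|C| \<le>o |K|" by auto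
    show "a \<in> {{}} \<union> ?F"
    proof (cases "C = {}")
      case False
      have le: "|C| \<le>o |underS r \<nu>|" by (rule ordLeq_ordIso_trans[OF C(3) ordIso_symmetric[OF \<nu>(3)]])
      obtain g where g: "g ` underS r \<nu> = C" using iffD2[OF card_of_ordLeq2[OF False] le] by auto
      \<comment> \<open>\<open>Func\<close> demands the value \<open>undefined\<close> outside
        \<open>underS r \<nu>\<close>.\<close>
      define q where "q i = (if i \<in> underS r \<nu> then inv_into (underS r \<theta>) t (g i) else undefined)" for i
      have tg: "t (q i) = g i" "q i \<in> underS r \<theta>" if "i \<in> underS r \<nu>" for i
      proof -
        have "g i \<in> t ` underS r \<theta>" using g C(2) t that unfolding bij_betw_def by auto
        then show "t (q i) = g i" "q i \<in> underS r \<theta>"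
          using that unfolding q_def by (auto simp: f_inv_into_f inv_into_into)
      qed
      have "q \<in> Func (underS r \<nu>) (underS r \<theta>)" using tg(2) unfolding Func_def q_def by auto
      moreover have "t ` q ` underS r \<nu> = C" using g tg(1) by (force simp: image_image)
      ultimately have "a \<in> ?F" unfolding C(1) by (intro image_eqI[of _ _ q]) auto
      then show ?thesis by simp
    qed (simp add: C(1))
  qed
  ultimately show ?thesis by (rule ordLeq_ordLess_trans[OF card_of_mono1, rotated])
qed

section \<open>From the singular \<open>\<mu>\<close> to one cover size for all of lambda\<close>

lemma strong_limit_singular_below:
  assumes sl: "strong_limit r \<mu>" and X: "X \<subseteq> underS r \<mu>" "is_sup r X \<mu>" "|X| <o |underS r \<mu>|"
  shows "strong_limit_singular (underS r \<mu>) (underS r ` X)"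
proof
  have \<mu>: "is_cardinal r \<mu>" using sl unfolding strong_limit_def by simp
  note \<mu>F = is_cardinalD(1)[OF \<mu>]
  show "infinite (underS r \<mu>)" using sl unfolding strong_limit_def by simp
  show "|underS r ` X| <o |underS r \<mu>|" by (rule ordLeq_ordLess_trans[OF card_of_image X(3)])
  show "|K| <o |underS r \<mu>|" if "K \<in> underS r ` X" for K
    using that X(1) card_underS_cardinal[OF \<mu>] by auto
  fix Y assume "|Y| <o |underS r \<mu>|"
  then obtain \<nu> where \<nu>: "\<nu> \<in> underS r \<mu>" "is_cardinal r \<nu>" "|underS r \<nu>| =o |Y|"
    using ex_cardinal_below[OF \<mu>F] by auto
  have "|Pow (underS r \<nu>)| <o |underS r \<mu>|"
    using sl \<nu>(1,2) unfolding strong_limit_def olt_def ord_card_def by (simp add: in_underS)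
  then show "|Pow Y| <o |underS r \<mu>|"
    by (rule ordLeq_ordLess_trans[OF card_Pow_mono[OF ordIso_imp_ordLeq[OF ordIso_symmetric[OF \<nu>(3)]]]])
  obtain m where m: "m \<in> X" "\<nu> \<in> underS r m"
    using is_sup_ex_above[OF X(2) _ \<nu>(1)] X(1) underS_sub[of \<mu>] by auto
  have "underS r \<nu> \<subseteq> underS r m" using m(2) underS_mono by (simp add: in_underS)
  then have "|Y| \<le>o |underS r m|"
    by (rule ordLeq_transitive[OF ordIso_imp_ordLeq[OF ordIso_symmetric[OF \<nu>(3)]] card_of_mono1])
  then show "\<exists>K\<in>underS r ` X. |Y| \<le>o |K|" using m(1) by auto
qed

text \<open>Otherwise each of the fewer than lambda candidates \<open>K\<close> fails from some
  \<open>d K\<close> on; by regularity of lambda one \<open>\<beta>\<close> lies beyond all of them,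
  against \<open>revised_GCH\<close> at \<open>\<beta>\<close>.\<close>

lemma ex_uniform_cover:
  assumes SL: "strong_limit_singular (underS r \<mu>) \<K>" and \<mu>: "\<mu> \<in> Field r"
  shows "\<exists>K\<in>\<K>. \<forall>\<delta>\<in>Field r. \<exists>\<beta>. (\<delta>, \<beta>) \<in> r \<and> pointwise_cover (underS r \<mu>) (underS r \<beta>) K"
proof (rule ccontr)
  assume "\<not> ?thesis"
  then have "\<forall>K\<in>\<K>. \<exists>\<delta>. \<delta> \<in> Field r \<and> (\<forall>\<beta>. (\<delta>, \<beta>) \<in> r \<longrightarrow> \<not> pointwise_cover (underS r \<mu>) (underS r \<beta>) K)"
    by auto
  then obtain d where d: "\<forall>K\<in>\<K>. d K \<in> Field r \<and>
      (\<forall>\<beta>. (d K, \<beta>) \<in> r \<longrightarrow> \<not> pointwise_cover (underS r \<mu>) (underS r \<beta>) K)" by (rule exE[OF bchoice])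
  have "|d ` \<K>| <o |Field r|"
    by (rule ordLeq_ordLess_trans[OF card_of_image
        ordLess_transitive[OF strong_limit_singular.small_index[OF SL] card_underS[OF \<mu>]]])
  then obtain \<beta> where \<beta>: "\<beta> \<in> Field r" "\<forall>x\<in>d ` \<K>. x \<in> underS r \<beta>"
    using small_bounded[of "d ` \<K>"] d by auto
  obtain K where K: "K \<in> \<K>" "pointwise_cover (underS r \<mu>) (underS r \<beta>) K"
    using strong_limit_singular.revised_GCH[OF SL, of "underS r \<beta>"] by (rule bexE)
  then show False using d \<beta>(2) by (auto simp: in_underS)
qed

end

subsection \<open>Guessing unbounded sets\<close>

theorem theorem2p2:
  fixes r :: "'a rel" and \<mu> :: 'a
  assumes lam_card: "Card_order r"
    and lam_inf: "infinite (Field r)"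
    and lam_reg: "regularCard r"
    and mu_sl: "strong_limit r \<mu>"
    and mu_sing: "singular r \<mu>"
  shows "\<exists>\<kappa>\<^sub>0. is_cardinal r \<kappa>\<^sub>0 \<and> olt r \<kappa>\<^sub>0 \<mu> \<and>
    (\<forall>\<kappa>. is_regular r \<kappa> \<and> (\<kappa>\<^sub>0, \<kappa>) \<in> r \<and> olt r \<kappa> \<mu> \<longrightarrow>
      (top_pow_below_eq r \<kappa> \<longrightarrow>
         (\<exists>P :: 'a \<Rightarrow> 'a set set.
            (\<forall>\<delta>\<in>S_cof r \<kappa>. small_family r \<kappa> \<delta> (P \<delta>)) \<and>
            (\<forall>A. A \<subseteq> Field r \<and> (card_of A, card_of (Field r)) \<in> ordIso \<longrightarrow>
               stationary r {\<delta> \<in> S_cof r \<kappa>. \<exists>X\<in>P \<delta>. X \<subseteq> A \<and> is_sup r X \<delta>})))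
      \<and>
      (\<exists>P0 :: 'a \<Rightarrow> 'a set set.
         (\<forall>\<delta>\<in>S_cof r \<kappa>. small_family r \<kappa> \<delta> (P0 \<delta>)) \<and>
         (\<forall>A. A \<subseteq> Field r \<and> (card_of A, card_of (Field r)) \<in> ordIso \<longrightarrow>
            (\<exists>E. club r E \<and> (\<forall>\<delta>\<in>E \<inter> S_cof r \<kappa>. \<exists>a\<in>P0 \<delta>. is_sup r (A \<inter> a) \<delta>))))
      \<and>
      ((\<forall>\<theta>. is_cardinal r \<theta> \<longrightarrow> pow_below_lt_top r \<theta> \<kappa>) \<longrightarrow>
         (\<exists>R :: 'a \<Rightarrow> 'a set set.
            (\<forall>\<delta>\<in>S_cof r \<kappa>. small_family r \<kappa> \<delta> (R \<delta>)) \<and>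
            (\<forall>a :: 'a \<Rightarrow> 'a set.
               (\<forall>\<delta>\<in>S_cof r \<kappa>. a \<delta> \<subseteq> underS r \<delta> \<and>
                   (Restr r (a \<delta>), Restr r (underS r \<kappa>)) \<in> ordLeq) \<longrightarrow>
               (\<exists>C. club r C \<and> (\<forall>\<delta>\<in>C \<inter> S_cof r \<kappa>. a \<delta> \<in> R \<delta>))))))"
proof -
  interpret regular_cardinal r using lam_card lam_inf lam_reg by unfold_locales
  have \<mu>: "is_cardinal r \<mu>" using mu_sl unfolding strong_limit_def by simp
  note \<mu>F = is_cardinalD(1)[OF \<mu>]
  obtain \<nu> X where \<nu>: "olt r \<nu> \<mu>" and X: "X \<subseteq> underS r \<mu>" "is_sup r X \<mu>" "|X| =o |underS r \<nu>|"
    using mu_sing unfolding singular_def cof_eq_def ord_card_def by auto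
  have "|underS r \<nu>| <o |underS r \<mu>|"
    using \<nu> by (intro card_underS_cardinal[OF \<mu>]) (simp add: olt_def in_underS)
  then have X\<mu>: "|X| <o |underS r \<mu>|" by (rule ordIso_ordLess_trans[OF X(3)])
  note SL = strong_limit_singular_below[OF mu_sl X(1,2) X\<mu>]
  obtain K where K: "K \<in> underS r ` X"
    and cov: "\<forall>\<delta>\<in>Field r. \<exists>\<beta>. (\<delta>, \<beta>) \<in> r \<and> pointwise_cover (underS r \<mu>) (underS r \<beta>) K"
    using ex_uniform_cover[OF SL \<mu>F] by (rule bexE)
  have "|Pow K| <o |underS r \<mu>|"
    by (rule strong_limit_singular.small_Pow[OF SL strong_limit_singular.small_\<K>[OF SL K]])
  \<comment> \<open>Passing to the power set gives a strict inequality, so that |K| is below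
    \<open>\<kappa>\<close> even when \<open>\<kappa> = \<kappa>\<^sub>0\<close>.\<close>
  then obtain \<kappa>\<^sub>0 where \<kappa>0: "\<kappa>\<^sub>0 \<in> underS r \<mu>" "is_cardinal r \<kappa>\<^sub>0" "|underS r \<kappa>\<^sub>0| =o |Pow K|"
    using ex_cardinal_below[OF \<mu>F] by auto
  have K\<kappa>: "|K| <o |underS r \<kappa>|" if "(\<kappa>\<^sub>0, \<kappa>) \<in> r" for \<kappa>
  proof -
    have "|K| <o |underS r \<kappa>\<^sub>0|" by (rule ordLess_ordIso_trans[OF card_of_Pow ordIso_symmetric[OF \<kappa>0(3)]])
    then show ?thesis by (rule ordLess_ordLeq_trans[OF _ card_of_mono1[OF underS_mono[OF that]]])
  qed
  \<comment> \<open>One family for each \<open>\<delta>\<close> serves all three statements: the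
    first two use a cofinal piece, the third takes all unions of at most |K| pieces.\<close>
  define good where "good \<kappa> \<delta> P \<longleftrightarrow> small_family r \<kappa> \<delta> P \<and>
    (\<forall>a. a \<subseteq> underS r \<delta> \<longrightarrow> |a| \<le>o |underS r \<kappa>| \<longrightarrow> (\<exists>C\<subseteq>P. |C| \<le>o |K| \<and> a = \<Union>C))" for \<kappa> \<delta> P
  have ex_good: "\<exists>P. \<forall>\<delta>\<in>Field r. good \<kappa> \<delta> (P \<delta>)" if "olt r \<kappa> \<mu>" for \<kappa>
  proof -
    have small: "|underS r \<kappa>| <o |underS r \<mu>|"
      using that by (intro card_underS_cardinal[OF \<mu>]) (simp add: olt_def in_underS)
    have pow: "|Pow (underS r \<kappa>)| <o |Field r|"
      by (rule ordLess_transitive[OF strong_limit_singular.small_Pow[OF SL small] card_underS[OF \<mu>F]])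
    have "\<forall>\<delta>\<in>Field r. \<exists>P. good \<kappa> \<delta> P"
    proof
      fix \<delta> assume "\<delta> \<in> Field r"
      then obtain \<beta> where \<beta>: "(\<delta>, \<beta>) \<in> r" "pointwise_cover (underS r \<mu>) (underS r \<beta>) K" using cov by auto
      show "\<exists>P. good \<kappa> \<delta> P" unfolding good_def by (rule ex_union_family[OF \<beta>(2,1) small pow])
    qed
    then show ?thesis by (rule bchoice)
  qed
  have sup: "\<exists>X\<in>P. X \<subseteq> A \<and> is_sup r X \<delta>"
    if "good \<kappa> \<delta> P" "(\<kappa>\<^sub>0, \<kappa>) \<in> r" "\<delta> \<in> S_cof r \<kappa>" "is_sup r (A \<inter> underS r \<delta>) \<delta>" for \<kappa> \<delta> P A
  proof (rule sup_in_family[OF _ that(4) K\<kappa>[OF that(2)]])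
    show "cof_eq r \<delta> \<kappa>" using that(3) unfolding S_cof_def by simp
    show "\<exists>C\<subseteq>P. |C| \<le>o |K| \<and> a = \<Union>C" if "a \<subseteq> underS r \<delta>" "|a| \<le>o |underS r \<kappa>|" for a
      using \<open>good \<kappa> \<delta> P\<close> that unfolding good_def by simp
    show "X \<subseteq> underS r \<delta>" if "X \<in> P" for X
      using \<open>good \<kappa> \<delta> P\<close> that unfolding good_def small_family_def small_subset_def by simp
  qed
  have S_Field: "S_cof r \<kappa> \<subseteq> Field r" for \<kappa> unfolding S_cof_def by auto
  show ?thesis
  proof (intro exI[of _ \<kappa>\<^sub>0] conjI[OF \<kappa>0(2)] conjI allI impI, goal_cases)
    case 1
    then show ?case using \<kappa>0(1) by (simp add: olt_def in_underS)
  next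
    case hyp: (2 \<kappa>)
    obtain P where P: "\<forall>\<delta>\<in>Field r. good \<kappa> \<delta> (P \<delta>)" using ex_good hyp(1) by auto
    show ?case
    proof (intro exI[of _ P] conjI ballI allI impI)
      show "small_family r \<kappa> \<delta> (P \<delta>)" if "\<delta> \<in> S_cof r \<kappa>" for \<delta>
        using P that S_Field unfolding good_def by auto
      fix A assume A: "A \<subseteq> Field r \<and> |A| =o |Field r|"
      show "stationary r {\<delta>\<in>S_cof r \<kappa>. \<exists>X\<in>P \<delta>. X \<subseteq> A \<and> is_sup r X \<delta>}"
        unfolding stationary_def
      proof (intro conjI allI impI)
        fix C assume C: "club r C"
        have "\<exists>\<delta>\<in>C \<inter> S_cof r \<kappa>. (\<mu>, \<delta>) \<in> r \<and> is_sup r (A \<inter> underS r \<delta>) \<delta>"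
          using hyp(1) A by (intro ex_limit_point[OF _ C unbounded_if_card \<mu>F]) auto
        then obtain \<delta> where \<delta>: "\<delta> \<in> C" "\<delta> \<in> S_cof r \<kappa>" "is_sup r (A \<inter> underS r \<delta>) \<delta>" by auto
        have "\<exists>X\<in>P \<delta>. X \<subseteq> A \<and> is_sup r X \<delta>"
          using P \<delta> S_Field hyp(1) by (intro sup[of \<kappa>]) auto
        then show "{\<delta>\<in>S_cof r \<kappa>. \<exists>X\<in>P \<delta>. X \<subseteq> A \<and> is_sup r X \<delta>} \<inter> C \<noteq> {}" using \<delta>(1,2) by auto
      qed (use S_Field in auto)
    qed
  next
    case hyp: (3 \<kappa>)
    obtain P where P: "\<forall>\<delta>\<in>Field r. good \<kappa> \<delta> (P \<delta>)" using ex_good hyp by auto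
    show ?case
    proof (intro exI[of _ P] conjI ballI allI impI)
      show "small_family r \<kappa> \<delta> (P \<delta>)" if "\<delta> \<in> S_cof r \<kappa>" for \<delta>
        using P that S_Field unfolding good_def by auto
      fix A assume A: "A \<subseteq> Field r \<and> |A| =o |Field r|"
      let ?E = "{\<delta>\<in>Field r. is_sup r (A \<inter> underS r \<delta>) \<delta>}"
      have "club r ?E" using hyp A by (intro club_limit_points[of \<kappa>] unbounded_if_card) auto
      moreover have "\<exists>a\<in>P \<delta>. is_sup r (A \<inter> a) \<delta>" if \<delta>: "\<delta> \<in> ?E \<inter> S_cof r \<kappa>" for \<delta>
      proof -
        have "\<exists>X\<in>P \<delta>. X \<subseteq> A \<and> is_sup r X \<delta>" using P \<delta> hyp by (intro sup[of \<kappa>]) auto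
        then obtain X where X: "X \<in> P \<delta>" "X \<subseteq> A" "is_sup r X \<delta>" by auto
        then have "A \<inter> X = X" by auto
        then show ?thesis using X by (intro bexI[of _ X]) simp_all
      qed
      ultimately show "\<exists>E. club r E \<and> (\<forall>\<delta>\<in>E \<inter> S_cof r \<kappa>. \<exists>a\<in>P \<delta>. is_sup r (A \<inter> a) \<delta>)" by blast
    qed
  next
    case hyp: (4 \<kappa>)
    obtain P where P: "\<forall>\<delta>\<in>Field r. good \<kappa> \<delta> (P \<delta>)" using ex_good hyp(1) by auto
    \<comment> \<open>Each \<open>a \<delta>\<close> in question is such a union at every
      \<open>\<delta>\<close>, so the club may be all of \<open>Field r\<close>.\<close>
    define R where "R \<delta> = {a\<in>{\<Union>C | C. C \<subseteq> P \<delta> \<and> |C| \<le>o |K|}. small_subset r \<kappa> \<delta> a}" for \<delta>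
    show ?case
    proof (intro exI[of _ R] conjI ballI allI impI)
      fix \<delta> assume \<delta>: "\<delta> \<in> S_cof r \<kappa>"
      then have "|P \<delta>| <o |Field r|" using P S_Field unfolding good_def small_family_def by auto
      then have "|{\<Union>C | C. C \<subseteq> P \<delta> \<and> |C| \<le>o |K|}| <o |Field r|"
        using hyp by (intro card_unions[of \<kappa>] K\<kappa>) (auto simp: is_regular_def)
      then have "|R \<delta>| <o |Field r|" unfolding R_def by (rule ordLeq_ordLess_trans[OF card_of_mono1, rotated]) auto
      then show "small_family r \<kappa> \<delta> (R \<delta>)" unfolding small_family_def R_def by simp
    next
      fix a assume a: "\<forall>\<delta>\<in>S_cof r \<kappa>. a \<delta> \<subseteq> underS r \<delta> \<and> Restr r (a \<delta>) \<le>o Restr r (underS r \<kappa>)"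
      have "a \<delta> \<in> R \<delta>" if \<delta>: "\<delta> \<in> S_cof r \<kappa>" for \<delta>
      proof -
        have sub: "a \<delta> \<subseteq> underS r \<delta>" using a \<delta> by simp
        then have F: "a \<delta> \<subseteq> Field r" using underS_sub by blast
        \<comment> \<open>The bound on the order type yields a bound on the cardinality, which is
          what \<open>good\<close> asks for.\<close>
        have "|Field (Restr r (a \<delta>))| \<le>o |Field (Restr r (underS r \<kappa>))|"
          using a \<delta> by (intro card_of_mono2) simp
        then have le: "|a \<delta>| \<le>o |underS r \<kappa>|" unfolding Field_Restr[OF F] Field_Restr[OF underS_sub] .
        have "good \<kappa> \<delta> (P \<delta>)" using P \<delta> S_Field by auto
        then have "\<exists>C\<subseteq>P \<delta>. |C| \<le>o |K| \<and> a \<delta> = \<Union>C" using sub le unfolding good_def by simp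
        moreover have "small_subset r \<kappa> \<delta> (a \<delta>)" using sub le unfolding small_subset_def ord_card_def by simp
        ultimately show ?thesis unfolding R_def by auto
      qed
      then show "\<exists>C. club r C \<and> (\<forall>\<delta>\<in>C \<inter> S_cof r \<kappa>. a \<delta> \<in> R \<delta>)"
        using club_Field by (intro exI[of _ "Field r"]) auto
    qed
  qed
qed

end
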